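(* Let $G$ be a connected graph of order $n$. Then $h_p(G)\le \max\{1,\,n-\mathrm{diam}(G)-1\}$.
   Context: Graphs are finite, undirected and loopless (multiple edges are allowed). The line graph $L(G)$ has vertex set $E(G)$, two vertices being adjacent if and only if the corresponding edges of $G$ share an endpoint; $L^0(G)=G$, $L^1(G)=L(G)$, $L^m(G)=L(L^{m-1}(G))$ (with $L^{m-1}(G)$ assumed to have a nonempty edge set). A graph is traceable if it has a hamiltonian path. The hamiltonian path index $h_p(G)$ is the minimum integer $m\ge 0$ such that $L^m(G)$ is traceable (so $h_p(G)=0$ if $G$ is traceable). $\mathrm{diam}(G)$ is the greatest distance between two vertices of $G$. *)

theory Defs
  imports Main "HOL-Library.FSet" "HOL-Library.Extended_Nat"
begin

record ('v, 'e) multigraph =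
  verts :: "'v set"
  edges :: "'e set"
  ends :: "'e \<Rightarrow> 'v set"

definition finite_loopless_multigraph :: "('v, 'e) multigraph \<Rightarrow> bool" where
  "finite_loopless_multigraph G \<longleftrightarrow>
     finite (verts G) \<and> finite (edges G) \<and>
     (\<forall>e\<in>edges G. ends G e \<subseteq> verts G \<and> card (ends G e) = 2)"

definition adjacent :: "('v, 'e) multigraph \<Rightarrow> 'v \<Rightarrow> 'v \<Rightarrow> bool" where
  "adjacent G u v \<longleftrightarrow> (\<exists>e\<in>edges G. ends G e = {u, v})"

text \<open>A walk is given by its nonempty list of vertices, so its length as a walk is one less
  than the length of the list. Which of several parallel edges is used plays no role below.\<close>

definition walk :: "('v, 'e) multigraph \<Rightarrow> 'v list \<Rightarrow> bool" where
  "walk G xs \<longleftrightarrow> xs \<noteq> [] \<and> set xs \<subseteq> verts G \<and> successively (adjacent G) xs"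

definition connected_graph :: "('v, 'e) multigraph \<Rightarrow> bool" where
  "connected_graph G \<longleftrightarrow> verts G \<noteq> {} \<and>
     (\<forall>u\<in>verts G. \<forall>v\<in>verts G. \<exists>xs. walk G xs \<and> hd xs = u \<and> last xs = v)"

definition graph_dist :: "('v, 'e) multigraph \<Rightarrow> 'v \<Rightarrow> 'v \<Rightarrow> nat" where
  "graph_dist G u v =
     (LEAST k. \<exists>xs. walk G xs \<and> hd xs = u \<and> last xs = v \<and> length xs = Suc k)"

definition graph_diam :: "('v, 'e) multigraph \<Rightarrow> nat" where
  "graph_diam G = Max {graph_dist G u v | u v. u \<in> verts G \<and> v \<in> verts G}"

definition hamiltonian_path :: "('v, 'e) multigraph \<Rightarrow> 'v list \<Rightarrow> bool" where
  "hamiltonian_path G xs \<longleftrightarrow> walk G xs \<and> distinct xs \<and> set xs = verts G"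

definition traceable :: "('v, 'e) multigraph \<Rightarrow> bool" where
  "traceable G \<longleftrightarrow> (\<exists>xs. hamiltonian_path G xs)"

text \<open>The vertices of a line graph are the edges of the original graph and its edges are unordered
  pairs of these, so every application would change the type. The following type contains
  the vertices and edges of \<open>G\<close> and is closed under forming unordered pairs; hence
  all iterated line graphs of \<open>G\<close> live in it.\<close>

datatype ('v, 'e) element = Vertex 'v | Edge 'e | Join "('v, 'e) element fset"

fun joined :: "('v, 'e) element \<Rightarrow> ('v, 'e) element set" where
  "joined (Join S) = fset S"
| "joined (Vertex v) = {}"
| "joined (Edge e) = {}"

fun embed_ends :: "('v, 'e) multigraph \<Rightarrow> ('v, 'e) element \<Rightarrow> ('v, 'e) element set" where
  "embed_ends G (Edge e) = Vertex ` ends G e"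
| "embed_ends G (Vertex v) = {}"
| "embed_ends G (Join S) = {}"

definition embed ::
  "('v, 'e) multigraph \<Rightarrow> (('v, 'e) element, ('v, 'e) element) multigraph" where
  "embed G = \<lparr>verts = Vertex ` verts G, edges = Edge ` edges G, ends = embed_ends G\<rparr>"

definition line_graph ::
  "(('v, 'e) element, ('v, 'e) element) multigraph \<Rightarrow>
   (('v, 'e) element, ('v, 'e) element) multigraph" where
  "line_graph H =
     \<lparr>verts = edges H,
      edges = {Join {|e, f|} | e f.
                 e \<in> edges H \<and> f \<in> edges H \<and> e \<noteq> f \<and> ends H e \<inter> ends H f \<noteq> {}},
      ends = joined\<rparr>"

definition iterated_line_graph ::
  "nat \<Rightarrow> ('v, 'e) multigraph \<Rightarrow> (('v, 'e) element, ('v, 'e) element) multigraph" where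
  "iterated_line_graph m G = (line_graph ^^ m) (embed G)"

text \<open>The \<open>m\<close>-th iterated line graph is only considered when all earlier ones have an edge.
  The index is \<open>\<infinity>\<close> if no iterated line graph is traceable, so a finite upper bound on it
  includes the existence of a traceable one.\<close>

definition hamiltonian_path_index :: "('v, 'e) multigraph \<Rightarrow> enat" where
  "hamiltonian_path_index G =
     Inf {enat m | m. (\<forall>k<m. edges (iterated_line_graph k G) \<noteq> {}) \<and>
                      traceable (iterated_line_graph m G)}"

lemma adjacent_embed [simp]:
  fixes G :: "('v, 'e) multigraph"
  shows "adjacent (embed G) (Vertex u) (Vertex v) \<longleftrightarrow> adjacent G u v"
proof -
  have "(Vertex ` A :: ('v, 'e) element set) = {Vertex u, Vertex v} \<longleftrightarrow> A = {u, v}" for A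
    using inj_image_eq_iff[of "Vertex :: 'v \<Rightarrow> ('v, 'e) element" A "{u, v}"]
    by (simp add: inj_def)
  then show ?thesis by (simp add: adjacent_def embed_def)
qed

lemma traceable_embed: "traceable (embed G) \<longleftrightarrow> traceable G"
proof -
  have walk: "hamiltonian_path (embed G) (map Vertex xs) \<longleftrightarrow> hamiltonian_path G xs" for xs
  proof -
    have "Vertex ` set xs = Vertex ` verts G \<longleftrightarrow> set xs = verts G"
      by (rule inj_image_eq_iff) (simp add: inj_def)
    moreover have "verts (embed G) = Vertex ` verts G" by (simp add: embed_def)
    ultimately show ?thesis
      by (auto simp: hamiltonian_path_def walk_def successively_map distinct_map inj_on_def)
  qed
  have "\<exists>xs. ys = map Vertex xs" if "hamiltonian_path (embed G) ys" for ys
  proof -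
    have "set ys \<subseteq> range Vertex"
      using that by (auto simp: hamiltonian_path_def embed_def)
    then have "\<forall>y\<in>set ys. \<exists>x. y = Vertex x" by blast
    then show ?thesis by (simp add: ex_map_conv)
  qed
  then show ?thesis unfolding traceable_def using walk by blast
qed

lemma adjacent_line_graph:
  "adjacent (line_graph H) e f \<longleftrightarrow>
     e \<in> edges H \<and> f \<in> edges H \<and> e \<noteq> f \<and> ends H e \<inter> ends H f \<noteq> {}"
proof
  assume "adjacent (line_graph H) e f"
  then obtain a b where "a \<in> edges H" "b \<in> edges H" "a \<noteq> b" "ends H a \<inter> ends H b \<noteq> {}"
    and "joined (Join {|a, b|}) = {e, f}"
    unfolding adjacent_def line_graph_def multigraph.simps by blast
  then have "{a, b} = {e, f}" by simp
  with \<open>a \<in> edges H\<close> \<open>b \<in> edges H\<close> \<open>a \<noteq> b\<close> \<open>ends H a \<inter> ends H b \<noteq> {}\<close>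
  show "e \<in> edges H \<and> f \<in> edges H \<and> e \<noteq> f \<and> ends H e \<inter> ends H f \<noteq> {}"
    unfolding doubleton_eq_iff by blast
next
  assume *: "e \<in> edges H \<and> f \<in> edges H \<and> e \<noteq> f \<and> ends H e \<inter> ends H f \<noteq> {}"
  then have "Join {|e, f|} \<in> edges (line_graph H)"
    unfolding line_graph_def by auto
  moreover have "ends (line_graph H) (Join {|e, f|}) = {e, f}"
    by (simp add: line_graph_def)
  ultimately show "adjacent (line_graph H) e f"
    unfolding adjacent_def by blast
qed

end

theory Submission
  imports Defs
begin

text \<open>
  Let \<open>p\<close> be a shortest path between two vertices at maximal distance; there are
  \<open>k = n - diam G - 1\<close> vertices outside it. For \<open>k = 0\<close> it is hamiltonian, and for \<open>k = 1\<close> it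
  meets every edge, so that listing each edge at the first vertex of \<open>p\<close> it contains traces the
  line graph. For \<open>k \<ge> 2\<close> let \<open>U\<close> consist of \<open>p\<close> and all vertices of degree at least 3. The at most
  \<open>k\<close> remaining vertices have degree at most 2, and at most \<open>k - 2\<close> of them
  suffice to connect \<open>U\<close>. Passing to the line graph, with the edges meeting \<open>p\<close> (again a path) and those meeting \<open>U\<close> in the roles
  of \<open>p\<close> and \<open>U\<close>, lowers both numbers by one, since vertices of degree at most 2 attached to \<open>U\<close>
  span fewer edges than vertices. After \<open>k - 2\<close> rounds \<open>U\<close> is connected and at most two vertices
  lie outside it.

  In the next line graph \<open>L\<close> take the edge set of the path and repeatedly replace it by its
  symmetric difference with a triangle whose vertices it does not yet connect: this preserves all
  parities of degrees and only enlarges the reachability relation. In the end every triangle lies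
  in one component. The edges at a vertex of \<open>U\<close> are pairwise joined by triangles or all lie on the
  path, so one component contains all edges meeting \<open>U\<close>. At most one vertex of \<open>L\<close> is missed, so an
  Euler trail of that component meets every edge of \<open>L\<close>, and the line graph of \<open>L\<close> is
  traceable.
\<close>

section \<open>Connectedness\<close>

text \<open>Connectedness by closed sets instead of walks: for a symmetric \<open>r\<close> it says
  that the graph induced on \<open>S\<close> is connected or empty. The same notion serves for
  vertices under adjacency, for edges in a line graph and for reachability relations.\<close>

definition conn :: "'a set \<Rightarrow> ('a \<Rightarrow> 'a \<Rightarrow> bool) \<Rightarrow> bool" where
  "conn S r \<longleftrightarrow> (\<forall>X\<subseteq>S. X \<noteq> {} \<longrightarrow> (\<forall>x\<in>X. \<forall>y\<in>S. r x y \<longrightarrow> y \<in> X) \<longrightarrow> X = S)"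

lemma connI:
  assumes "\<And>X. X \<subseteq> S \<Longrightarrow> X \<noteq> {} \<Longrightarrow> (\<And>x y. x \<in> X \<Longrightarrow> y \<in> S \<Longrightarrow> r x y \<Longrightarrow> y \<in> X) \<Longrightarrow> S \<subseteq> X"
  shows "conn S r"
  unfolding conn_def using assms by (metis subset_antisym)

lemma connD:
  assumes "conn S r" "X \<subseteq> S" "X \<noteq> {}" "\<And>x y. x \<in> X \<Longrightarrow> y \<in> S \<Longrightarrow> r x y \<Longrightarrow> y \<in> X"
  shows "X = S"
  using assms unfolding conn_def by blast

lemma conn_cut:
  assumes "conn S r" "X \<subseteq> S" "X \<noteq> {}" "X \<noteq> S"
  obtains x y where "x \<in> X" "y \<in> S - X" "r x y"
  using assms unfolding conn_def by blast

lemma conn_Un: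
  assumes "conn S r" "conn T r" "S \<inter> T \<noteq> {}"
  shows "conn (S \<union> T) r"
proof (rule connI)
  fix X assume X: "X \<subseteq> S \<union> T" "X \<noteq> {}"
    and cl: "\<And>x y. x \<in> X \<Longrightarrow> y \<in> S \<union> T \<Longrightarrow> r x y \<Longrightarrow> y \<in> X"
  have S: "X \<inter> S \<noteq> {} \<Longrightarrow> X \<inter> S = S" by (rule connD[OF assms(1)]) (use cl in auto)
  have T: "X \<inter> T \<noteq> {} \<Longrightarrow> X \<inter> T = T" by (rule connD[OF assms(2)]) (use cl in auto)
  show "S \<union> T \<subseteq> X" using S T X assms(3) by blast
qed

lemma adjacent_sym: "adjacent G u v \<Longrightarrow> adjacent G v u"
  unfolding adjacent_def by (metis insert_commute)

lemma conn_successively: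
  assumes "symp r" "successively r xs"
  shows "conn (set xs) r"
  using assms(2)
proof (induction xs rule: induct_list012)
  case 1
  then show ?case by (simp add: conn_def)
next
  case (2 x)
  then show ?case by (auto intro: connI)
next
  case (3 x y zs)
  have "conn {x, y} r"
    using 3(3) assms(1) by (intro connI) (auto dest: sympD)
  then have "conn ({x, y} \<union> set (y # zs)) r"
    using 3 by (intro conn_Un) auto
  then show ?case by (simp add: insert_commute)
qed

lemma successively_closed:
  assumes "successively r xs" "xs \<noteq> []" "hd xs \<in> X"
    and "\<forall>x\<in>X. \<forall>y\<in>set xs. r x y \<longrightarrow> y \<in> X"
  shows "set xs \<subseteq> X"
  using assms
proof (induction xs rule: induct_list012)
  case (3 x y zs)
  have "r x y" "x \<in> X" using 3(3,5) by simp_all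
  then have "y \<in> X" using 3(6) by (meson list.set_intros)
  moreover have "successively r (y # zs)" using 3(3) by simp
  moreover have "\<forall>a\<in>X. \<forall>b\<in>set (y # zs). r a b \<longrightarrow> b \<in> X"
    using 3(6) by (meson list.set_intros(2))
  ultimately have "set (y # zs) \<subseteq> X" using 3(2) by simp
  then show ?case using \<open>x \<in> X\<close> by simp
qed simp_all

lemma connected_graph_conn:
  assumes "connected_graph G"
  shows "conn (verts G) (adjacent G)"
proof (rule connI)
  fix X assume X: "X \<subseteq> verts G" "X \<noteq> {}"
    and cl: "\<And>x y. x \<in> X \<Longrightarrow> y \<in> verts G \<Longrightarrow> adjacent G x y \<Longrightarrow> y \<in> X"
  show "verts G \<subseteq> X"
  proof
    fix v assume v: "v \<in> verts G"
    obtain x where x: "x \<in> X" using X by blast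
    then obtain xs where xs: "walk G xs" "hd xs = x" "last xs = v"
      using assms v X unfolding connected_graph_def by blast
    have "set xs \<subseteq> X"
      by (rule successively_closed[of "adjacent G"]) (use xs x cl in \<open>unfold walk_def, blast+\<close>)
    then show "v \<in> X" using xs by (auto simp: walk_def)
  qed
qed

section \<open>Trails\<close>

definition touching :: "('v, 'e) multigraph \<Rightarrow> 'v set \<Rightarrow> 'e set" where
  "touching G S = {e \<in> edges G. ends G e \<inter> S \<noteq> {}}"

definition degree :: "('v, 'e) multigraph \<Rightarrow> 'v \<Rightarrow> nat" where
  "degree G v = card {e \<in> edges G. v \<in> ends G e}"

text \<open>Trails are lists of edges because parallel edges must be told apart; that no edge
  repeats is demanded separately by \<open>distinct\<close>.\<close>

fun trail :: "('v, 'e) multigraph \<Rightarrow> 'v \<Rightarrow> 'e list \<Rightarrow> 'v \<Rightarrow> bool" where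
  "trail G x [] y \<longleftrightarrow> x = y"
| "trail G x (e # es) y \<longleftrightarrow> e \<in> edges G \<and> (\<exists>z. ends G e = {x, z} \<and> trail G z es y)"

definition on_trail :: "('v, 'e) multigraph \<Rightarrow> 'v \<Rightarrow> 'e list \<Rightarrow> 'v set" where
  "on_trail G x es = insert x (\<Union>(ends G ` set es))"

lemma trail_append: "trail G x (es @ fs) y \<longleftrightarrow> (\<exists>z. trail G x es z \<and> trail G z fs y)"
  by (induction es arbitrary: x) auto

lemma trail_edges: "trail G x es y \<Longrightarrow> set es \<subseteq> edges G"
  by (induction es arbitrary: x) auto

lemma trail_end: "trail G x es y \<Longrightarrow> y \<in> on_trail G x es"
  by (induction es arbitrary: x) (auto simp: on_trail_def)

lemma trail_split:
  assumes "trail G x es y" "p \<in> on_trail G x es"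
  obtains es1 es2 where "es = es1 @ es2" "trail G x es1 p" "trail G p es2 y"
  using assms
proof (induction es arbitrary: x thesis)
  case Nil
  then show ?case by (auto simp: on_trail_def)
next
  case (Cons e es)
  then obtain z where e: "e \<in> edges G" "ends G e = {x, z}" "trail G z es y" by auto
  show ?case
  proof (cases "p = x")
    case True
    then show ?thesis using Cons.prems by (metis append_Nil trail.simps(1))
  next
    case False
    then have "p \<in> on_trail G z es" using Cons.prems e by (auto simp: on_trail_def)
    then obtain es1 es2 where "es = es1 @ es2" "trail G z es1 p" "trail G p es2 y"
      using Cons.IH e(3) by blast
    then show ?thesis using Cons.prems(1)[of "e # es1" es2] e by auto
  qed
qed

lemma loopless_ends:
  assumes "finite_loopless_multigraph G" "e \<in> edges G"
  shows "card (ends G e) = 2" "ends G e \<subseteq> verts G"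
  using assms by (auto simp: finite_loopless_multigraph_def)

lemma ends_obtain:
  assumes "finite_loopless_multigraph G" "e \<in> edges G" "x \<in> ends G e"
  obtains y where "ends G e = {x, y}" "x \<noteq> y"
proof -
  obtain a b where "ends G e = {a, b}" "a \<noteq> b"
    using loopless_ends(1)[OF assms(1,2)] by (auto simp: card_2_iff)
  then show thesis using that[of a] that[of b] assms(3) by (auto simp: insert_commute)
qed

text \<open>Every passage through a vertex takes two edges, so only the ends of an open trail meet
  an odd number of them. In the induction, dropping the first edge flips the parity at exactly its
  two ends \<open>x\<close> and \<open>z\<close>.\<close>

lemma trail_parity:
  assumes "finite_loopless_multigraph G" "trail G x es y" "distinct es"
  shows "odd (card {e \<in> set es. v \<in> ends G e}) \<longleftrightarrow> (v = x) \<noteq> (v = y)"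
  using assms(2,3)
proof (induction es arbitrary: x)
  case Nil
  then show ?case by simp
next
  case (Cons e es)
  then obtain z where e: "e \<in> edges G" "ends G e = {x, z}" "trail G z es y" by auto
  have xz: "x \<noteq> z" using loopless_ends(1)[OF assms(1) e(1)] e(2) by auto
  have IH: "odd (card {e \<in> set es. v \<in> ends G e}) \<longleftrightarrow> (v = z) \<noteq> (v = y)"
    using Cons e by simp
  have "{e' \<in> set (e # es). v \<in> ends G e'} =
      (if v \<in> {x, z} then insert e {e \<in> set es. v \<in> ends G e} else {e \<in> set es. v \<in> ends G e})"
    using e(2) by auto
  moreover have "e \<notin> set es" using Cons.prems by simp
  ultimately have "card {e' \<in> set (e # es). v \<in> ends G e'} =
      (if v \<in> {x, z} then Suc (card {e \<in> set es. v \<in> ends G e}) else card {e \<in> set es. v \<in> ends G e})"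
    by simp
  then show ?case using IH xz by auto
qed

lemma trail_of_path:
  assumes "successively (adjacent G) xs" "distinct xs" "xs \<noteq> []"
  obtains es where "trail G (hd xs) es (last xs)" "distinct es" "on_trail G (hd xs) es = set xs"
  using assms
proof (induction xs arbitrary: thesis rule: induct_list012)
  case (2 x)
  show ?case by (rule 2(1)[of "[]"]) (auto simp: on_trail_def)
next
  case (3 x y zs)
  obtain es where es: "trail G y es (last (y # zs))" "distinct es" "on_trail G y es = set (y # zs)"
    using 3(2) 3(4-) by auto
  obtain e where e: "e \<in> edges G" "ends G e = {x, y}" using 3(4) by (auto simp: adjacent_def)
  have "e \<notin> set es"
  proof
    assume "e \<in> set es"
    then have "x \<in> on_trail G y es" using e by (auto simp: on_trail_def)
    then show False using es 3(5) by auto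
  qed
  then show ?case using es e
    by (intro 3(3)[of "e # es"]) (auto simp: on_trail_def)
qed auto

text \<open>Each edge outside the trail is listed at the first vertex of the trail that it contains.\<close>

lemma dominated_edges_list:
  assumes "trail G x es y" "distinct es" "finite D" "D \<inter> set es = {}"
    and "\<forall>e\<in>D. ends G e \<inter> on_trail G x es \<noteq> {}"
  shows "\<exists>l. distinct l \<and> set l = set es \<union> D \<and>
    successively (\<lambda>e f. ends G e \<inter> ends G f \<noteq> {}) l \<and> (l \<noteq> [] \<longrightarrow> x \<in> ends G (hd l))"
  using assms
proof (induction es arbitrary: x D)
  case Nil
  obtain l where l: "set l = D" "distinct l" using finite_distinct_list[OF Nil(3)] by blast
  have x: "\<forall>e\<in>set l. x \<in> ends G e" using Nil l by (auto simp: on_trail_def)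
  then have "successively (\<lambda>e f. ends G e \<inter> ends G f \<noteq> {}) l"
    by (induction l rule: induct_list012) auto
  then show ?case using l x by (metis Un_empty_left empty_set hd_in_set)
next
  case (Cons e es)
  then obtain z where e: "e \<in> edges G" "ends G e = {x, z}" "trail G z es y" by auto
  \<comment> \<open>The edges of \<open>D\<close> at \<open>x\<close> come first, then
    \<open>e\<close>, then the list obtained for the trail from \<open>z\<close>. The clause about
    \<open>hd l\<close> in the claim is what joins \<open>e\<close> to that list.\<close>
  let ?D = "{f \<in> D. x \<in> ends G f}"
  obtain ds where ds: "set ds = ?D" "distinct ds"
    using finite_distinct_list[of ?D] Cons.prems(3) by auto
  have "\<forall>f\<in>D - ?D. ends G f \<inter> on_trail G z es \<noteq> {}"
    using Cons.prems(5) e(2) by (auto simp: on_trail_def)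
  then obtain l where l: "distinct l" "set l = set es \<union> (D - ?D)"
    "successively (\<lambda>e f. ends G e \<inter> ends G f \<noteq> {}) l" "l \<noteq> [] \<longrightarrow> z \<in> ends G (hd l)"
    using Cons.IH[OF e(3), of "D - ?D"] Cons.prems by auto
  have x: "\<forall>f\<in>set ds. x \<in> ends G f" using ds by auto
  then have "successively (\<lambda>e f. ends G e \<inter> ends G f \<noteq> {}) ds"
    by (induction ds rule: induct_list012) auto
  moreover have "ds \<noteq> [] \<Longrightarrow> x \<in> ends G (last ds)" using x by simp
  ultimately have "successively (\<lambda>e f. ends G e \<inter> ends G f \<noteq> {}) (ds @ e # l)"
    using l(3,4) e(2) by (cases l) (auto simp: successively_append_iff)
  moreover have "distinct (ds @ e # l)" using ds l Cons.prems by auto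
  moreover have "set (ds @ e # l) = set (e # es) \<union> D" using ds l by auto
  moreover have "x \<in> ends G (hd (ds @ e # l))" using x e(2) by (cases ds) auto
  ultimately show ?case by blast
qed

section \<open>Euler trails\<close>

text \<open>A longest trail can be extended if it misses an edge: a closed one by rotating it, an open one
  by inserting a maximal trail through unused edges, which is closed because the unused edges
  have even degree everywhere.\<close>

lemma euler_trail:
  assumes G: "finite_loopless_multigraph G" and conn: "conn (verts G) (adjacent G)"
    and ne: "verts G \<noteq> {}" and two: "card {v \<in> verts G. odd (degree G v)} \<le> 2"
  obtains x es y where "trail G x es y" "distinct es" "set es = edges G" "on_trail G x es = verts G"
proof -
  have fin: "finite (edges G)" "finite (verts G)" using G by (auto simp: finite_loopless_multigraph_def)
  have len: "length es \<le> card (edges G)" if "trail G x es y" "distinct es" for x es y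
    using that by (metis card_mono distinct_card fin(1) trail_edges)
  define T where "T = {(x, es, y). x \<in> verts G \<and> trail G x es y \<and> distinct es}"
  obtain v where v: "v \<in> verts G" using ne by blast
  have "(v, [], v) \<in> T" using v by (simp add: T_def)
  moreover have "\<forall>t. t \<in> T \<longrightarrow> length (fst (snd t)) < Suc (card (edges G))"
    using len by (fastforce simp: T_def)
  ultimately obtain t where t: "t \<in> T" "\<forall>s. s \<in> T \<longrightarrow> length (fst (snd s)) \<le> length (fst (snd t))"
    using ex_has_greatest_nat[of "\<lambda>t. t \<in> T" _ "\<lambda>t. length (fst (snd t))"] by blast
  obtain x es y where xy: "t = (x, es, y)" by (metis prod_cases3)
  have tr: "x \<in> verts G" "trail G x es y" "distinct es" using t xy by (auto simp: T_def)
  have max: "length es' \<le> length es" if "x' \<in> verts G" "trail G x' es' y'" "distinct es'" for x' es' y'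
    using t(2)[rule_format, of "(x', es', y')"] that xy by (auto simp: T_def)
  let ?V = "on_trail G x es"
  have V: "?V \<subseteq> verts G"
    using tr trail_edges[OF tr(2)] loopless_ends(2)[OF G] by (fastforce simp: on_trail_def)
  have used: "?V = verts G" if "set es = edges G"
  proof (rule connD[OF conn V])
    show "?V \<noteq> {}" by (auto simp: on_trail_def)
    fix a b assume "a \<in> ?V" "b \<in> verts G" "adjacent G a b"
    then show "b \<in> ?V" unfolding adjacent_def using that by (force simp: on_trail_def)
  qed
  have "set es = edges G"
  proof (rule ccontr)
    assume "set es \<noteq> edges G"
    then obtain f where f: "f \<in> edges G" "f \<notin> set es" using trail_edges[OF tr(2)] by blast
    have "\<exists>f\<in>edges G - set es. ends G f \<inter> ?V \<noteq> {}"
    proof (cases "ends G f \<inter> ?V = {}")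
      case True
      moreover have "ends G f \<noteq> {}" "ends G f \<subseteq> verts G"
        using loopless_ends[OF G f(1)] by auto
      ultimately have "?V \<noteq> verts G" by blast
      moreover have "?V \<noteq> {}" by (auto simp: on_trail_def)
      ultimately obtain a b where "a \<in> ?V" "b \<in> verts G - ?V" "adjacent G a b"
        using conn_cut[OF conn V] by blast
      then obtain e where e: "e \<in> edges G" "ends G e = {a, b}" by (auto simp: adjacent_def)
      have "e \<notin> set es" using \<open>b \<in> verts G - ?V\<close> e(2) by (auto simp: on_trail_def)
      then show ?thesis using e \<open>a \<in> ?V\<close> by auto
    qed (use f in auto)
    then obtain f p where f: "f \<in> edges G" "f \<notin> set es" and p: "p \<in> ends G f" "p \<in> ?V" by blast
    obtain q where q: "ends G f = {p, q}" "p \<noteq> q" using ends_obtain[OF G f(1) p(1)] .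
    obtain es1 es2 where es: "es = es1 @ es2" "trail G x es1 p" "trail G p es2 y"
      using trail_split[OF tr(2) p(2)] .
    have pq: "p \<in> verts G" "q \<in> verts G" using q loopless_ends(2)[OF G f(1)] by auto
    show False
    proof (cases "x = y")
      case True
      then have "trail G q (f # es2 @ es1) p"
        using es q f by (auto simp: trail_append insert_commute)
      moreover have "distinct (f # es2 @ es1)" using es tr f by auto
      ultimately show False using max[of q "f # es2 @ es1" p] pq es by simp
    next
      case False
      have odd_end: "odd (degree G v)" if v: "v \<in> {x, y}" for v
      proof (rule ccontr)
        assume "\<not> odd (degree G v)"
        moreover have "odd (card {e \<in> set es. v \<in> ends G e})"
          using trail_parity[OF G tr(2,3)] v False by auto
        ultimately have "{e \<in> set es. v \<in> ends G e} \<noteq> {e \<in> edges G. v \<in> ends G e}"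
          by (metis degree_def)
        then obtain e where e: "e \<in> edges G" "e \<notin> set es" "v \<in> ends G e"
          using trail_edges[OF tr(2)] by blast
        obtain w where w: "ends G e = {v, w}" using ends_obtain[OF G e(1,3)] by blast
        have "w \<in> verts G" using w loopless_ends(2)[OF G e(1)] by auto
        then show False
          using max[of w "e # es" y] max[of x "es @ [e]" w] v e w tr
          by (auto simp: trail_append insert_commute)
      qed
      have "{x, y} \<subseteq> {v \<in> verts G. odd (degree G v)}"
        using odd_end tr trail_end[OF tr(2)] V by auto
      then have ev: "{x, y} = {v \<in> verts G. odd (degree G v)}"
        using two fin(2) False by (intro card_seteq) auto
      have even_rest: "even (card {e \<in> edges G - set es. v \<in> ends G e})" if "v \<in> verts G" for v
      proof -
        have "{e \<in> edges G - set es. v \<in> ends G e} =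
            {e \<in> edges G. v \<in> ends G e} - {e \<in> set es. v \<in> ends G e}" by auto
        then have "card {e \<in> edges G - set es. v \<in> ends G e} =
            degree G v - card {e \<in> set es. v \<in> ends G e}"
          unfolding degree_def using trail_edges[OF tr(2)] by (simp add: card_Diff_subset Collect_mono_iff subset_iff)
        moreover have "card {e \<in> set es. v \<in> ends G e} \<le> degree G v"
          unfolding degree_def using trail_edges[OF tr(2)] fin by (intro card_mono) auto
        moreover have "odd (card {e \<in> set es. v \<in> ends G e}) \<longleftrightarrow> odd (degree G v)"
          using trail_parity[OF G tr(2,3), of v] False ev that by auto
        ultimately show ?thesis by simp
      qed
      define T' where "T' = {(fs, z). trail G p fs z \<and> distinct fs \<and> set fs \<inter> set es = {}}"
      have "([f], q) \<in> T'" using f q by (simp add: T'_def)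
      moreover have "\<forall>t. t \<in> T' \<longrightarrow> length (fst t) < Suc (card (edges G))"
        using len by (fastforce simp: T'_def)
      ultimately obtain t' where t': "t' \<in> T'" "\<forall>s. s \<in> T' \<longrightarrow> length (fst s) \<le> length (fst t')"
        using ex_has_greatest_nat[of "\<lambda>t. t \<in> T'" _ "\<lambda>t. length (fst t)"] by blast
      obtain fs z where fz: "t' = (fs, z)" by force
      have tr': "trail G p fs z" "distinct fs" "set fs \<inter> set es = {}" using t' fz by (auto simp: T'_def)
      have ne: "fs \<noteq> []" using t'(2) \<open>([f], q) \<in> T'\<close> fz by force
      have zV: "z \<in> verts G"
        using trail_end[OF tr'(1)] pq trail_edges[OF tr'(1)] loopless_ends(2)[OF G]
        by (fastforce simp: on_trail_def)
      have "z = p"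
      proof (rule ccontr)
        assume "z \<noteq> p"
        then have "odd (card {e \<in> set fs. z \<in> ends G e})"
          using trail_parity[OF G tr'(1,2), of z] by auto
        then have "{e \<in> set fs. z \<in> ends G e} \<noteq> {e \<in> edges G - set es. z \<in> ends G e}"
          using even_rest[OF zV] by metis
        then obtain e where e: "e \<in> edges G" "e \<notin> set es" "e \<notin> set fs" "z \<in> ends G e"
          using trail_edges[OF tr'(1)] tr'(3) by blast
        obtain w where w: "ends G e = {z, w}" using ends_obtain[OF G e(1,4)] by blast
        have "(fs @ [e], w) \<in> T'" using tr' e w by (auto simp: T'_def trail_append)
        then show False using t'(2) fz by force
      qed
      then have "trail G x (es1 @ fs @ es2) y" using es tr' by (auto simp: trail_append)
      moreover have "distinct (es1 @ fs @ es2)" using es tr tr' by auto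
      ultimately show False using max[of x "es1 @ fs @ es2" y] tr es ne by simp
    qed
  qed
  then show thesis using that tr used by blast
qed

section \<open>Line graphs\<close>

lemma verts_line_graph [simp]: "verts (line_graph H) = edges H"
  and ends_line_graph [simp]: "ends (line_graph H) = joined"
  by (simp_all add: line_graph_def)

lemma Join_in_edges_line_graph:
  "Join {|e, f|} \<in> edges (line_graph H) \<longleftrightarrow>
    e \<in> edges H \<and> f \<in> edges H \<and> e \<noteq> f \<and> ends H e \<inter> ends H f \<noteq> {}"
proof -
  have *: "{|e, f|} = {|a, b|} \<longleftrightarrow> {e, f} = {a, b}" for a b
    by (metis bot_fset.rep_eq finsert.rep_eq fset_inject)
  show ?thesis
    unfolding line_graph_def multigraph.simps mem_Collect_eq element.inject * doubleton_eq_iff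
    by blast
qed

lemma edge_line_graph_cases:
  assumes "g \<in> edges (line_graph H)" "e \<in> joined g"
  obtains f where "g = Join {|e, f|}" "e \<in> edges H" "f \<in> edges H" "e \<noteq> f" "ends H e \<inter> ends H f \<noteq> {}"
proof -
  obtain a b where g: "g = Join {|a, b|}"
    using assms(1) unfolding line_graph_def multigraph.simps by blast
  then have "e = a \<or> e = b" using assms(2) by auto
  then show thesis
  proof
    assume "e = a"
    then show thesis using that[of b] assms(1) g Join_in_edges_line_graph[of a b H] by simp
  next
    assume "e = b"
    then show thesis
      using that[of a] assms(1) g Join_in_edges_line_graph[of b a H] by (simp add: finsert_commute)
  qed
qed

lemma finite_loopless_line_graph:
  assumes "finite_loopless_multigraph H"
  shows "finite_loopless_multigraph (line_graph H)"
proof -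
  have fin: "finite (edges H)" using assms by (simp add: finite_loopless_multigraph_def)
  have "edges (line_graph H) \<subseteq> (\<lambda>(e, f). Join {|e, f|}) ` (edges H \<times> edges H)"
    by (auto simp: line_graph_def)
  then have "finite (edges (line_graph H))"
    using fin by (meson finite_SigmaI finite_imageI finite_subset)
  moreover have "joined g \<subseteq> edges H \<and> card (joined g) = 2" if g: "g \<in> edges (line_graph H)" for g
  proof -
    obtain e f where "g = Join {|e, f|}" "e \<in> edges H" "f \<in> edges H" "e \<noteq> f"
      using g unfolding line_graph_def multigraph.simps by blast
    then show ?thesis by simp
  qed
  ultimately show ?thesis using fin by (simp add: finite_loopless_multigraph_def)
qed

text \<open>A closed set that meets \<open>D u\<close> contains it, since \<open>D u\<close> is a
  clique for \<open>r\<close>; an edge between \<open>u\<close> and \<open>v\<close> lies in both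
  \<open>D u\<close> and \<open>D v\<close>, so the closed set spreads over all of \<open>S\<close>.
  Every transfer of connectivity to a line graph rests on this.\<close>

lemma conn_incident_family:
  assumes "conn S (adjacent G)"
    and clique: "\<And>u e f. u \<in> S \<Longrightarrow> e \<in> D u \<Longrightarrow> f \<in> D u \<Longrightarrow> e \<noteq> f \<Longrightarrow> r e f"
    and edge: "\<And>e u v. e \<in> edges G \<Longrightarrow> ends G e = {u, v} \<Longrightarrow> u \<in> S \<Longrightarrow> v \<in> S \<Longrightarrow> e \<in> D u"
  shows "conn (\<Union>u\<in>S. D u) r"
proof (rule connI)
  fix X assume X: "X \<subseteq> (\<Union>u\<in>S. D u)" "X \<noteq> {}"
    and cl: "\<And>x y. x \<in> X \<Longrightarrow> y \<in> (\<Union>u\<in>S. D u) \<Longrightarrow> r x y \<Longrightarrow> y \<in> X"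
  have all: "D u \<subseteq> X" if "u \<in> S" "D u \<inter> X \<noteq> {}" for u
    using that cl clique by blast
  have "{u \<in> S. D u \<inter> X \<noteq> {}} = S"
  proof (rule connD[OF assms(1)])
    show "{u \<in> S. D u \<inter> X \<noteq> {}} \<noteq> {}" using X by blast
    fix u v assume u: "u \<in> {u \<in> S. D u \<inter> X \<noteq> {}}" and v: "v \<in> S" and "adjacent G u v"
    then obtain e where e: "e \<in> edges G" "ends G e = {u, v}" by (auto simp: adjacent_def)
    have "e \<in> D u" using edge e u v by blast
    moreover have "e \<in> D v" using edge[of e v u] e u v by (auto simp: insert_commute)
    ultimately show "v \<in> {u \<in> S. D u \<inter> X \<noteq> {}}" using all u v by blast
  qed blast
  then show "(\<Union>u\<in>S. D u) \<subseteq> X" using all by blast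
qed

lemma conn_line_graph:
  assumes "finite_loopless_multigraph H" "conn (verts H) (adjacent H)"
  shows "conn (edges H) (adjacent (line_graph H))"
proof -
  have "conn (\<Union>u\<in>verts H. {e \<in> edges H. u \<in> ends H e}) (adjacent (line_graph H))"
    by (rule conn_incident_family[OF assms(2)]) (auto simp: adjacent_line_graph)
  moreover have "(\<Union>u\<in>verts H. {e \<in> edges H. u \<in> ends H e}) = edges H"
  proof -
    have "\<exists>u\<in>verts H. u \<in> ends H e" if "e \<in> edges H" for e
      using loopless_ends[OF assms(1) that] by (metis card.empty ex_in_conv subsetD zero_neq_numeral)
    then show ?thesis by blast
  qed
  ultimately show ?thesis by simp
qed

lemma degree_line_graph_le:
  assumes "finite_loopless_multigraph H"
  shows "degree (line_graph H) e \<le> card {f \<in> edges H. f \<noteq> e \<and> ends H e \<inter> ends H f \<noteq> {}}"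
proof -
  let ?N = "{f \<in> edges H. f \<noteq> e \<and> ends H e \<inter> ends H f \<noteq> {}}"
  have fin: "finite ?N" using assms by (simp add: finite_loopless_multigraph_def)
  have "{g \<in> edges (line_graph H). e \<in> joined g} \<subseteq> (\<lambda>f. Join {|e, f|}) ` ?N"
  proof
    fix g assume "g \<in> {g \<in> edges (line_graph H). e \<in> joined g}"
    then obtain f where "g = Join {|e, f|}" "f \<in> edges H" "e \<noteq> f" "ends H e \<inter> ends H f \<noteq> {}"
      using edge_line_graph_cases by blast
    then show "g \<in> (\<lambda>f. Join {|e, f|}) ` ?N" by blast
  qed
  then have "degree (line_graph H) e \<le> card ((\<lambda>f. Join {|e, f|}) ` ?N)"
    unfolding degree_def ends_line_graph by (rule card_mono[OF finite_imageI[OF fin]])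
  also have "\<dots> \<le> card ?N" by (rule card_image_le[OF fin])
  finally show ?thesis .
qed

text \<open>Count the incidences with \<open>Z\<close>: the degrees allow at most
  \<open>2 * card Z\<close>, each inner edge uses two, and an edge leaving \<open>Z\<close> uses one
  more, so by integrality at least one inner edge is lost. For empty \<open>Z\<close> the truncated
  difference is 0, which is right because every edge has two ends.\<close>

lemma card_inner_edges_le:
  assumes G: "finite_loopless_multigraph G" and Z: "finite Z" "\<forall>z\<in>Z. degree G z \<le> 2"
    and out: "Z \<noteq> {} \<Longrightarrow> \<exists>a\<in>Z. \<exists>b. b \<notin> Z \<and> adjacent G a b"
  shows "card {e \<in> edges G. ends G e \<subseteq> Z} \<le> card Z - 1"
proof (cases "Z = {}")
  case True
  have "\<not> ends G e \<subseteq> Z" if "e \<in> edges G" for e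
    using loopless_ends(1)[OF G that] True by auto
  then have none: "{e \<in> edges G. ends G e \<subseteq> Z} = {}" by blast
  show ?thesis unfolding none by simp
next
  case False
  let ?I = "{e \<in> edges G. ends G e \<subseteq> Z}"
  have fin: "finite (edges G)" using G by (simp add: finite_loopless_multigraph_def)
  obtain a b e0 where e0: "a \<in> Z" "b \<notin> Z" "e0 \<in> edges G" "ends G e0 = {a, b}"
    using out[OF False] unfolding adjacent_def by blast
  have deg: "degree G z = (\<Sum>e\<in>edges G. if z \<in> ends G e then 1 else 0)" for z
    unfolding degree_def using fin by (simp add: sum.If_cases Int_def)
  have "card (Z \<inter> ends G e0) + 2 * card ?I =
      card (Z \<inter> ends G e0) + (\<Sum>e\<in>?I. card (Z \<inter> ends G e))"
    using loopless_ends(1)[OF G] by (simp add: Int_absorb1)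
  also have "\<dots> = (\<Sum>e\<in>insert e0 ?I. card (Z \<inter> ends G e))"
    using fin e0 by (subst sum.insert) auto
  also have "\<dots> \<le> (\<Sum>e\<in>edges G. card (Z \<inter> ends G e))"
    using fin e0(3) by (intro sum_mono2) auto
  also have "\<dots> = (\<Sum>e\<in>edges G. \<Sum>z\<in>Z. if z \<in> ends G e then 1 else 0)"
    using Z(1) by (simp add: sum.If_cases)
  also have "\<dots> = (\<Sum>z\<in>Z. degree G z)"
    unfolding deg by (rule sum.swap)
  also have "\<dots> \<le> (\<Sum>z\<in>Z. 2)" using Z(2) by (intro sum_mono) auto
  finally have "card (Z \<inter> ends G e0) + 2 * card ?I \<le> 2 * card Z" by simp
  moreover have "Z \<inter> ends G e0 = {a}" using e0 by auto
  ultimately show ?thesis by simp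
qed

text \<open>The analogue for paths of one direction of the Harary-Nash-Williams theorem: a trail
  strings all edges that meet it into a path of the line graph.\<close>

lemma dominating_path_line_graph:
  assumes "finite_loopless_multigraph H" "trail H x es y" "distinct es"
  obtains l where "distinct l" "set l = touching H (on_trail H x es)"
    "successively (adjacent (line_graph H)) l"
proof -
  let ?T = "touching H (on_trail H x es)"
  have fin: "finite (edges H)" using assms(1) by (simp add: finite_loopless_multigraph_def)
  have es: "set es \<subseteq> ?T"
  proof
    fix e assume e: "e \<in> set es"
    then have "e \<in> edges H" using trail_edges[OF assms(2)] by blast
    moreover from this have "ends H e \<noteq> {}" using loopless_ends(1)[OF assms(1), of e] by auto
    ultimately show "e \<in> ?T" using e by (auto simp: touching_def on_trail_def)
  qed
  have "\<exists>l. distinct l \<and> set l = set es \<union> (?T - set es) \<and>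
    successively (\<lambda>e f. ends H e \<inter> ends H f \<noteq> {}) l \<and> (l \<noteq> [] \<longrightarrow> x \<in> ends H (hd l))"
    by (rule dominated_edges_list[OF assms(2,3)]) (use fin in \<open>unfold touching_def, simp, blast, blast\<close>)
  then obtain l where l: "distinct l" "set l = ?T" "successively (\<lambda>e f. ends H e \<inter> ends H f \<noteq> {}) l"
    using es by blast
  have "set l \<subseteq> edges H" using l(2) by (auto simp: touching_def)
  with l(3,1) have "successively (adjacent (line_graph H)) l"
    by (induction l rule: induct_list012) (auto simp: adjacent_line_graph)
  then show thesis using that l by blast
qed

text \<open>Such a graph is a single vertex. This settles the cases in which the iteration runs out
  of edges.\<close>

lemma traceable_edgeless:
  assumes "conn (verts G) (adjacent G)" "verts G \<noteq> {}" "edges G = {}"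
  shows "traceable G"
proof -
  obtain v where "v \<in> verts G" using assms(2) by blast
  then have "{v} = verts G"
    by (intro connD[OF assms(1)]) (use assms(3) in \<open>auto simp: adjacent_def\<close>)
  then have "hamiltonian_path G [v]" by (auto simp: hamiltonian_path_def walk_def)
  then show ?thesis by (auto simp: traceable_def)
qed

lemma traceable_line_graph:
  assumes "finite_loopless_multigraph H" "trail H x es y" "distinct es"
    and "touching H (on_trail H x es) = edges H" "edges H \<noteq> {}"
  shows "traceable (line_graph H)"
proof -
  obtain l where l: "distinct l" "set l = edges H" "successively (adjacent (line_graph H)) l"
    using dominating_path_line_graph[OF assms(1-3)] assms(4) by metis
  moreover have "l \<noteq> []" using l assms(5) by auto
  ultimately have "hamiltonian_path (line_graph H) l"
    by (auto simp: hamiltonian_path_def walk_def)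
  then show ?thesis by (auto simp: traceable_def)
qed

text \<open>Read the path as a trail and list the edges meeting it. The result is again a path,
  which takes over the role of \<open>p\<close> one level higher.\<close>

lemma path_line_graph:
  assumes H: "finite_loopless_multigraph H" "conn (verts H) (adjacent H)" "edges H \<noteq> {}"
    and p: "walk H p" "distinct p"
  obtains l where "walk (line_graph H) l" "distinct l" "set l = touching H (set p)"
proof -
  have p': "p \<noteq> []" "set p \<subseteq> verts H" "successively (adjacent H) p" using p by (auto simp: walk_def)
  obtain es where es: "trail H (hd p) es (last p)" "distinct es" "on_trail H (hd p) es = set p"
    using trail_of_path[OF p'(3) p(2) p'(1)] .
  obtain l where l: "distinct l" "set l = touching H (set p)" "successively (adjacent (line_graph H)) l"
    using dominating_path_line_graph[OF H(1) es(1,2)] es(3) by metis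
  \<comment> \<open>A walk must be a nonempty list: either \<open>p\<close> covers all vertices and
    any edge will do, or connectivity provides an edge leaving \<open>set p\<close>.\<close>
  have "touching H (set p) \<noteq> {}"
  proof (cases "set p = verts H")
    case True
    obtain e where e: "e \<in> edges H" using H(3) by blast
    then have "ends H e \<noteq> {}" "ends H e \<subseteq> verts H"
      using loopless_ends[OF H(1) e] by auto
    then show ?thesis using e True by (auto simp: touching_def)
  next
    case False
    have "set p \<noteq> {}" using p' by simp
    then obtain a b where "a \<in> set p" "adjacent H a b"
      using conn_cut[OF H(2) p'(2) _ False] by blast
    then show ?thesis by (auto simp: touching_def adjacent_def)
  qed
  then have "walk (line_graph H) l" using l by (auto simp: walk_def touching_def)
  then show thesis using that l by blast
qed

section \<open>Switching triangles\<close>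

lemma even_card_sym_diff:
  assumes "finite A" "finite B"
  shows "even (card ((A - B) \<union> (B - A))) \<longleftrightarrow> (even (card A) \<longleftrightarrow> even (card B))"
proof -
  have "card ((A - B) \<union> (B - A)) = card (A - B) + card (B - A)"
    using assms by (intro card_Un_disjoint) auto
  moreover have "card A = card (A - B) + card (A \<inter> B)"
    using assms(1) by (metis card_Int_Diff add.commute)
  moreover have "card B = card (B - A) + card (A \<inter> B)"
    using assms(2) by (metis card_Int_Diff add.commute inf_commute)
  ultimately show ?thesis by (simp only: even_add) blast
qed

abbreviation reach :: "('v, 'e) multigraph \<Rightarrow> 'e set \<Rightarrow> 'v \<Rightarrow> 'v \<Rightarrow> bool" where
  "reach G F \<equiv> (adjacent (G\<lparr>edges := F\<rparr>))\<^sup>*\<^sup>*"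

lemma reach_sym: "reach G F x y \<Longrightarrow> reach G F y x"
  by (rule sympD[OF symp_rtranclp[OF sympI[OF adjacent_sym]]])

lemma adjacent_sub: "adjacent (G\<lparr>edges := F\<rparr>) u v \<longleftrightarrow> (\<exists>e\<in>F. ends G e = {u, v})"
  by (simp add: adjacent_def)

lemma degree_sub: "degree (G\<lparr>edges := F\<rparr>) v = card {e \<in> F. v \<in> ends G e}"
  by (simp add: degree_def)

lemma reach_edge: "e \<in> F \<Longrightarrow> ends G e = {u, v} \<Longrightarrow> reach G F u v"
  using adjacent_sub by (metis r_into_rtranclp)

text \<open>Each vertex lies on none or two of the triangle edges, so no parity changes. As
  \<open>F\<close> does not connect \<open>x\<close> and \<open>y\<close>, it contains at most one
  of the three edges; after the switch at least two are present and connect \<open>x\<close>,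
  \<open>y\<close>, \<open>z\<close>, so removing an edge of the triangle disconnects
  nothing.\<close>

lemma triangle_switch:
  assumes G: "finite_loopless_multigraph G" and F: "F \<subseteq> edges G"
    and T: "{a, b, c} \<subseteq> edges G" "ends G a = {x, y}" "ends G b = {y, z}" "ends G c = {z, x}"
    and nr: "\<not> reach G F x y"
  obtains F' where "F' \<subseteq> edges G"
    "\<And>v. odd (degree (G\<lparr>edges := F'\<rparr>) v) \<longleftrightarrow> odd (degree (G\<lparr>edges := F\<rparr>) v)"
    "\<And>u w. reach G F u w \<Longrightarrow> reach G F' u w" "reach G F' x y"
proof -
  define F' where "F' = (F - {a, b, c}) \<union> ({a, b, c} - F)"
  have fin: "finite F" using F G by (auto simp: finite_loopless_multigraph_def intro: finite_subset)
  have d: "x \<noteq> y" "y \<noteq> z" "z \<noteq> x"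
    using loopless_ends(1)[OF G] T by fastforce+
  have d': "a \<noteq> b" "b \<noteq> c" "c \<noteq> a" using d T by (auto simp: doubleton_eq_iff)
  have sub: "F' \<subseteq> edges G" using F T by (auto simp: F'_def)
  have par: "odd (degree (G\<lparr>edges := F'\<rparr>) v) \<longleftrightarrow> odd (degree (G\<lparr>edges := F\<rparr>) v)" for v
  proof -
    let ?A = "{e \<in> F. v \<in> ends G e}" and ?B = "{e \<in> {a, b, c}. v \<in> ends G e}"
    have "?B = (if v = x then {a, c} else if v = y then {a, b} else if v = z then {b, c} else {})"
      using T d by auto
    then have "even (card ?B)" using d' by auto
    moreover have "{e \<in> F'. v \<in> ends G e} = (?A - ?B) \<union> (?B - ?A)" by (auto simp: F'_def)
    ultimately show ?thesis
      unfolding degree_sub using even_card_sym_diff[of ?A ?B] fin by simp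
  qed
  have a: "a \<notin> F" using nr reach_edge[of a F G] T(2) by blast
  have bc: "b \<notin> F \<or> c \<notin> F"
  proof (rule ccontr)
    assume "\<not> ?thesis"
    then have "reach G F y z" "reach G F z x"
      using reach_edge[of b F G] reach_edge[of c F G] T by blast+
    then show False using nr reach_sym[where G = G and F = F] by (meson rtranclp_trans)
  qed
  have xy: "reach G F' x y"
    using reach_edge[of a F' G] a T(2) by (simp add: F'_def)
  moreover have "reach G F' y z \<or> reach G F' z x"
    using reach_edge[of b F' G] reach_edge[of c F' G] bc T(3,4) by (auto simp: F'_def)
  ultimately have r: "reach G F' x y" "reach G F' y z" "reach G F' x z"
    using reach_sym[where G = G and F = F'] by (meson rtranclp_trans)+
  have xyz: "reach G F' u w" if "{u, w} \<subseteq> {x, y, z}" for u w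
    using that r r[THEN reach_sym] by auto
  have adj_reach: "reach G F' u w" if uw: "adjacent (G\<lparr>edges := F\<rparr>) u w" for u w
  proof -
    obtain e where e: "e \<in> F" "ends G e = {u, w}" using uw unfolding adjacent_sub by blast
    show ?thesis
    proof (cases "e \<in> {a, b, c}")
      case True
      then have "ends G e \<subseteq> {x, y, z}" using T by blast
      then show ?thesis using e(2) xyz by simp
    next
      case False
      then have "e \<in> F'" using e by (simp add: F'_def)
      then show ?thesis using e(2) by (rule reach_edge)
    qed
  qed
  have mono: "reach G F' u w" if "reach G F u w" for u w
    using that
  proof induction
    case (step v w)
    show ?case by (rule rtranclp_trans[OF step.IH adj_reach[OF step.hyps(2)]])
  qed simp
  show thesis by (rule that[OF sub par mono xy])
qed

text \<open>Among all edge sets with the parities of \<open>F0\<close> that preserve its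
  reachability, take one with the most reachable pairs of vertices. A triangle with unconnected
  vertices would allow a switch that gains a pair.\<close>

lemma triangle_connected_subgraph:
  assumes G: "finite_loopless_multigraph G" and F0: "F0 \<subseteq> edges G"
  obtains F where "F \<subseteq> edges G"
    "\<And>v. odd (degree (G\<lparr>edges := F\<rparr>) v) \<longleftrightarrow> odd (degree (G\<lparr>edges := F0\<rparr>) v)"
    "\<And>x y. reach G F0 x y \<Longrightarrow> reach G F x y"
    "\<And>a b c x y z. {a, b, c} \<subseteq> edges G \<Longrightarrow> ends G a = {x, y} \<Longrightarrow> ends G b = {y, z} \<Longrightarrow>
      ends G c = {z, x} \<Longrightarrow> reach G F x y"
proof -
  define C where "C = {F. F \<subseteq> edges G \<and> 
    (\<forall>v. odd (degree (G\<lparr>edges := F\<rparr>) v) \<longleftrightarrow> odd (degree (G\<lparr>edges := F0\<rparr>) v)) \<and>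
    (\<forall>x y. reach G F0 x y \<longrightarrow> reach G F x y)}"
  define R where "R = (\<lambda>F. {xy \<in> verts G \<times> verts G. reach G F (fst xy) (snd xy)})"
  have fin: "finite (verts G \<times> verts G)" using G by (simp add: finite_loopless_multigraph_def)
  have "card (R F) < Suc (card (verts G \<times> verts G))" for F
    using fin by (simp add: R_def card_mono less_Suc_eq_le)
  moreover have "F0 \<in> C" using F0 by (simp add: C_def)
  ultimately obtain F where F: "F \<in> C" "\<forall>F'. F' \<in> C \<longrightarrow> card (R F') \<le> card (R F)"
    using ex_has_greatest_nat[of "\<lambda>F. F \<in> C" F0 "\<lambda>F. card (R F)"] by blast
  show thesis
  proof (rule that[of F])
    fix a b c x y z
    assume T: "{a, b, c} \<subseteq> edges G" "ends G a = {x, y}" "ends G b = {y, z}" "ends G c = {z, x}"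
    show "reach G F x y"
    proof (rule ccontr)
      assume nr: "\<not> reach G F x y"
      have "F \<subseteq> edges G" using F(1) by (simp add: C_def)
      then obtain F' where F': "F' \<subseteq> edges G"
        "\<And>v. odd (degree (G\<lparr>edges := F'\<rparr>) v) \<longleftrightarrow> odd (degree (G\<lparr>edges := F\<rparr>) v)"
        "\<And>u w. reach G F u w \<Longrightarrow> reach G F' u w" "reach G F' x y"
        using triangle_switch[OF G _ T nr] by metis
      have "F' \<in> C" using F(1) F' unfolding C_def by blast
      moreover have "card (R F) < card (R F')"
      proof (rule psubset_card_mono)
        show "finite (R F')" using fin by (simp add: R_def)
        have "(x, y) \<in> R F' - R F"
          using F'(4) nr loopless_ends(2)[OF G, of a] T by (auto simp: R_def)
        moreover have "R F \<subseteq> R F'" using F'(3) by (auto simp: R_def)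
        ultimately show "R F \<subset> R F'" by blast
      qed
      ultimately show False using F(2) by (simp add: leD)
    qed
  qed (use F(1) in \<open>auto simp: C_def\<close>)
qed

section \<open>The reduction step\<close>

text \<open>In the line graph, any two edges at a triangular vertex lie in a common triangle. A vertex of
  degree at least 3 is triangular; unlike the degree bound, this passes to the line graph.\<close>

definition triangular :: "('v, 'e) multigraph \<Rightarrow> 'v \<Rightarrow> bool" where
  "triangular G u \<longleftrightarrow> (\<forall>e f. e \<in> edges G \<and> f \<in> edges G \<and> e \<noteq> f \<and> u \<in> ends G e \<and> u \<in> ends G f \<longrightarrow>
    (\<exists>g\<in>edges G. g \<noteq> e \<and> g \<noteq> f \<and> ends G e \<inter> ends G g \<noteq> {} \<and> ends G f \<inter> ends G g \<noteq> {}))"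

text \<open>\<open>m\<close> bounds the number of line graph steps still needed. For \<open>m = 2\<close> the connecting set \<open>Z\<close>
  is empty, so \<open>U\<close> itself is connected.\<close>

definition skeleton :: "('v, 'e) multigraph \<Rightarrow> 'v list \<Rightarrow> 'v set \<Rightarrow> nat \<Rightarrow> bool" where
  "skeleton G p U m \<longleftrightarrow>
    finite_loopless_multigraph G \<and> conn (verts G) (adjacent G) \<and>
    walk G p \<and> distinct p \<and> set p \<subseteq> U \<and> U \<subseteq> verts G \<and>
    (\<forall>v\<in>verts G - U. degree G v \<le> 2) \<and> card (verts G - U) \<le> m \<and>
    (\<forall>u\<in>U - set p. triangular G u) \<and>
    (\<exists>Z\<subseteq>verts G - U. conn (U \<union> Z) (adjacent G) \<and> card Z + 2 \<le> m)"

text \<open>A third edge at \<open>u\<close> meets both given ones.\<close>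

lemma triangularI_degree:
  assumes "finite_loopless_multigraph G" "degree G u \<ge> 3"
  shows "triangular G u"
  unfolding triangular_def
proof (intro allI impI)
  fix e f assume ef: "e \<in> edges G \<and> f \<in> edges G \<and> e \<noteq> f \<and> u \<in> ends G e \<and> u \<in> ends G f"
  have "\<not> {g \<in> edges G. u \<in> ends G g} \<subseteq> {e, f}"
  proof
    assume "{g \<in> edges G. u \<in> ends G g} \<subseteq> {e, f}"
    then have "degree G u \<le> card {e, f}" unfolding degree_def by (intro card_mono) auto
    also have "\<dots> \<le> 2" by (simp add: card_insert_if)
    finally show False using assms(2) by simp
  qed
  then show "\<exists>g\<in>edges G. g \<noteq> e \<and> g \<noteq> f \<and> ends G e \<inter> ends G g \<noteq> {} \<and> ends G f \<inter> ends G g \<noteq> {}"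
    using ef by blast
qed

text \<open>Two edges at \<open>e\<close> are pairs \<open>{e, f}\<close> and
  \<open>{e, f'}\<close>. If \<open>f\<close> and \<open>f'\<close> meet, the pair
  \<open>{f, f'}\<close> serves. Otherwise one of them contains \<open>u\<close>, since they cannot
  share the other end of \<open>e\<close>; triangularity at \<open>u\<close> then yields an edge
  \<open>h\<close> that meets \<open>e\<close> and this one, hence differs from the other, and
  \<open>{e, h}\<close> serves.\<close>

lemma triangular_line_graph:
  assumes H: "finite_loopless_multigraph H" and e: "e \<in> edges H" "u \<in> ends H e"
    and tri: "triangular H u"
  shows "triangular (line_graph H) e"
  unfolding triangular_def ends_line_graph
proof (intro allI impI, elim conjE)
  fix a b assume ab: "a \<in> edges (line_graph H)" "b \<in> edges (line_graph H)" "a \<noteq> b" "e \<in> joined a" "e \<in> joined b"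
  obtain f where f: "a = Join {|e, f|}" "f \<in> edges H" "e \<noteq> f" "ends H e \<inter> ends H f \<noteq> {}"
    using edge_line_graph_cases[OF ab(1,4)] .
  obtain f' where f': "b = Join {|e, f'|}" "f' \<in> edges H" "e \<noteq> f'" "ends H e \<inter> ends H f' \<noteq> {}"
    using edge_line_graph_cases[OF ab(2,5)] .
  have ff': "f \<noteq> f'" using ab(3) f(1) f'(1) by blast
  obtain v where v: "ends H e = {u, v}" using ends_obtain[OF H e] by blast
  show "\<exists>c\<in>edges (line_graph H). c \<noteq> a \<and> c \<noteq> b \<and> joined a \<inter> joined c \<noteq> {} \<and> joined b \<inter> joined c \<noteq> {}"
  proof (cases "ends H f \<inter> ends H f' = {}")
    case False
    let ?c = "Join {|f, f'|}"
    have "?c \<in> edges (line_graph H)" using False f f' ff' by (simp add: Join_in_edges_line_graph)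
    moreover have "e \<notin> joined ?c" "f \<in> joined ?c" "f' \<in> joined ?c" using f(3) f'(3) by simp_all
    moreover from this have "?c \<noteq> a" "?c \<noteq> b" using ab(4,5) by metis+
    moreover have "f \<in> joined a" "f' \<in> joined b" using f(1) f'(1) by simp_all
    ultimately show ?thesis by blast
  next
    case True
    have "\<exists>h\<in>edges H. h \<noteq> e \<and> h \<noteq> f \<and> h \<noteq> f' \<and> ends H e \<inter> ends H h \<noteq> {}"
    proof (cases "u \<in> ends H f")
      case uf: True
      obtain g where "g \<in> edges H" "g \<noteq> e" "g \<noteq> f" "ends H e \<inter> ends H g \<noteq> {}" "ends H f \<inter> ends H g \<noteq> {}"
        using tri e f(2,3) uf unfolding triangular_def by blast
      then show ?thesis using True by blast
    next
      case False
      then have "v \<in> ends H f" using f(4) unfolding v by blast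
      then have "u \<in> ends H f'" using f'(4) True unfolding v by blast
      then obtain g where "g \<in> edges H" "g \<noteq> e" "g \<noteq> f'" "ends H e \<inter> ends H g \<noteq> {}" "ends H f' \<inter> ends H g \<noteq> {}"
        using tri e f'(2,3) unfolding triangular_def by blast
      then show ?thesis using True by blast
    qed
    then obtain h where h: "h \<in> edges H" "h \<noteq> e" "h \<noteq> f" "h \<noteq> f'" "ends H e \<inter> ends H h \<noteq> {}" by blast
    let ?c = "Join {|e, h|}"
    have "?c \<in> edges (line_graph H)" using h e by (simp add: Join_in_edges_line_graph)
    moreover have "e \<in> joined ?c" "h \<in> joined ?c" by simp_all
    moreover have "h \<notin> joined a" "h \<notin> joined b" using h f(1) f'(1) by simp_all
    moreover from calculation have "?c \<noteq> a" "?c \<noteq> b" by metis+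
    ultimately show ?thesis using ab(4,5) by blast
  qed
qed

lemma untouched_edges:
  assumes "finite_loopless_multigraph H"
  shows "edges H - touching H U = {e \<in> edges H. ends H e \<subseteq> verts H - U}"
  using loopless_ends(2)[OF assms] unfolding touching_def by blast

text \<open>Each of the two ends of \<open>e\<close> carries at most one further edge.\<close>

lemma degree_line_graph_le_2:
  assumes H: "finite_loopless_multigraph H" and e: "e \<in> edges H"
    and deg: "\<forall>x\<in>ends H e. degree H x \<le> 2"
  shows "degree (line_graph H) e \<le> 2"
proof -
  have fin: "finite (edges H)" using H by (simp add: finite_loopless_multigraph_def)
  obtain x y where xy: "ends H e = {x, y}"
    using loopless_ends(1)[OF H e] unfolding card_2_iff by blast
  let ?S = "\<lambda>x. {f \<in> edges H. x \<in> ends H f} - {e}"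
  have le: "card (?S z) \<le> 1" if "z \<in> ends H e" for z
  proof -
    have "card (?S z) = degree H z - 1"
      unfolding degree_def using that e by (subst card_Diff_singleton) auto
    then show ?thesis using deg that by fastforce
  qed
  have "degree (line_graph H) e \<le> card {f \<in> edges H. f \<noteq> e \<and> ends H e \<inter> ends H f \<noteq> {}}"
    by (rule degree_line_graph_le[OF H])
  also have "\<dots> \<le> card (?S x \<union> ?S y)"
    using fin xy by (intro card_mono) auto
  also have "\<dots> \<le> card (?S x) + card (?S y)" by (rule card_Un_le)
  also have "\<dots> \<le> 2" using le[of x] le[of y] xy by simp
  finally show ?thesis .
qed

text \<open>Connectivity of \<open>U \<union> Z\<close> with \<open>U\<close> nonempty provides the
  edge leaving \<open>Z\<close> that the count requires. It is applied to the whole complement of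
  \<open>U\<close> and to the connecting set.\<close>

lemma card_inner_edges_conn:
  assumes G: "finite_loopless_multigraph G" and Z: "Z \<subseteq> verts G - U" "\<forall>z\<in>Z. degree G z \<le> 2"
    and "conn (U \<union> Z) (adjacent G)" "U \<noteq> {}"
  shows "card {e \<in> edges G. ends G e \<subseteq> Z} \<le> card Z - 1"
proof (rule card_inner_edges_le[OF G _ Z(2)])
  show "finite Z" using G Z(1) by (meson finite_Diff finite_loopless_multigraph_def finite_subset)
  assume "Z \<noteq> {}"
  moreover have "Z \<noteq> U \<union> Z" using Z(1) assms(5) by blast
  ultimately show "\<exists>a\<in>Z. \<exists>b. b \<notin> Z \<and> adjacent G a b"
    using conn_cut[OF assms(4), of Z] by blast
qed

text \<open>An edge with both ends in \<open>U \<union> Z\<close> meets \<open>U\<close> or lies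
  inside \<open>Z\<close>, so the family of edges at the vertices of \<open>U \<union> Z\<close> is
  connected. The relation \<open>r\<close> stays open to cover both adjacency in the line graph and
  reachability in a switched edge set.\<close>

lemma conn_touching:
  assumes H: "finite_loopless_multigraph H" and c: "conn (U \<union> Z) (adjacent H)"
    and r: "\<And>u e f. u \<in> U \<union> Z \<Longrightarrow> u \<in> ends H e \<Longrightarrow> u \<in> ends H f \<Longrightarrow>
      e \<in> touching H U \<union> {e \<in> edges H. ends H e \<subseteq> Z} \<Longrightarrow>
      f \<in> touching H U \<union> {e \<in> edges H. ends H e \<subseteq> Z} \<Longrightarrow> e \<noteq> f \<Longrightarrow> r e f"
  shows "conn (touching H U \<union> {e \<in> edges H. ends H e \<subseteq> Z}) r"
proof -
  let ?E = "touching H U \<union> {e \<in> edges H. ends H e \<subseteq> Z}"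
  have "conn (\<Union>u\<in>U \<union> Z. {e \<in> ?E. u \<in> ends H e}) r"
  proof (rule conn_incident_family[OF c, where D = "\<lambda>u. {e \<in> ?E. u \<in> ends H e}"])
    fix u e f
    assume "u \<in> U \<union> Z" "e \<in> {e \<in> ?E. u \<in> ends H e}" "f \<in> {e \<in> ?E. u \<in> ends H e}" "e \<noteq> f"
    then show "r e f" by (intro r[of u e f]) simp_all
  next
    fix e u v
    assume "e \<in> edges H" "ends H e = {u, v}" "u \<in> U \<union> Z" "v \<in> U \<union> Z"
    then show "e \<in> {e \<in> ?E. u \<in> ends H e}" by (auto simp: touching_def)
  qed
  moreover have "(\<Union>u\<in>U \<union> Z. {e \<in> ?E. u \<in> ends H e}) = ?E"
  proof -
    have "ends H e \<inter> (U \<union> Z) \<noteq> {}" if e: "e \<in> ?E" for e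
    proof -
      have "e \<in> edges H" using e unfolding touching_def by blast
      then have "ends H e \<noteq> {}" using loopless_ends(1)[OF H, of e] by auto
      then show ?thesis using e unfolding touching_def by blast
    qed
    then show ?thesis by blast
  qed
  ultimately show ?thesis by simp
qed

text \<open>The edges inside the complement of \<open>U\<close> form the new complement, those
  inside \<open>Z\<close> the new connecting set; by \<open>card_inner_edges_conn\<close> each is
  smaller by at least one unless it was empty.\<close>

lemma skeleton_line_graph:
  assumes sk: "skeleton H p U (Suc m)" and m: "2 \<le> m" and ne: "edges H \<noteq> {}"
  shows "\<exists>p'. skeleton (line_graph H) p' (touching H U) m"
proof -
  have H: "finite_loopless_multigraph H" and c: "conn (verts H) (adjacent H)"
    and p: "walk H p" "distinct p" "set p \<subseteq> U" and U: "U \<subseteq> verts H"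
    and deg: "\<forall>v\<in>verts H - U. degree H v \<le> 2" and W: "card (verts H - U) \<le> Suc m"
    and tri: "\<forall>u\<in>U - set p. triangular H u"
    using sk unfolding skeleton_def by blast+
  obtain Z where Z: "Z \<subseteq> verts H - U" "conn (U \<union> Z) (adjacent H)" "card Z + 2 \<le> Suc m"
    using sk unfolding skeleton_def by blast
  have U0: "U \<noteq> {}" using p unfolding walk_def by auto
  obtain l where l: "walk (line_graph H) l" "distinct l" "set l = touching H (set p)"
    using path_line_graph[OF H c ne p(1,2)] .
  have out: "verts (line_graph H) - touching H U = {e \<in> edges H. ends H e \<subseteq> verts H - U}"
    using untouched_edges[OF H] by simp
  let ?Z = "{e \<in> edges H. ends H e \<subseteq> Z}"
  have "skeleton (line_graph H) l (touching H U) m"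
    unfolding skeleton_def
  proof (intro conjI)
    show "finite_loopless_multigraph (line_graph H)" by (rule finite_loopless_line_graph[OF H])
    show "conn (verts (line_graph H)) (adjacent (line_graph H))"
      using conn_line_graph[OF H c] by simp
    show "walk (line_graph H) l" "distinct l" by (fact l)+
    show "set l \<subseteq> touching H U" using l(3) p(3) unfolding touching_def by blast
    show "touching H U \<subseteq> verts (line_graph H)" unfolding touching_def by auto
    show "\<forall>v\<in>verts (line_graph H) - touching H U. degree (line_graph H) v \<le> 2"
    proof
      fix e assume "e \<in> verts (line_graph H) - touching H U"
      then have "e \<in> edges H" "\<forall>x\<in>ends H e. degree H x \<le> 2" using deg unfolding out by blast+
      then show "degree (line_graph H) e \<le> 2" by (rule degree_line_graph_le_2[OF H])
    qed
    have "card {e \<in> edges H. ends H e \<subseteq> verts H - U} \<le> card (verts H - U) - 1"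
    proof (rule card_inner_edges_conn[OF H order_refl deg _ U0])
      show "conn (U \<union> (verts H - U)) (adjacent H)" using c U by (simp add: Un_absorb1)
    qed
    then show "card (verts (line_graph H) - touching H U) \<le> m" using W unfolding out by simp
    show "\<forall>e\<in>touching H U - set l. triangular (line_graph H) e"
    proof
      fix e assume e: "e \<in> touching H U - set l"
      then obtain u where u: "u \<in> U" "u \<in> ends H e" "e \<in> edges H" unfolding touching_def by blast
      then have "u \<notin> set p" using e l(3) unfolding touching_def by blast
      then show "triangular (line_graph H) e"
        using triangular_line_graph[OF H u(3,2)] tri u by blast
    qed
    have "?Z \<subseteq> verts (line_graph H) - touching H U" using Z(1) unfolding out by blast
    moreover have "conn (touching H U \<union> ?Z) (adjacent (line_graph H))"
      by (rule conn_touching[OF H Z(2)]) (auto simp: adjacent_line_graph touching_def)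
    moreover have "card ?Z + 2 \<le> m"
    \<comment> \<open>An empty connecting set cannot shrink; then the bound comes from
      \<open>2 \<le> m\<close>.\<close>
    proof (cases "Z = {}")
      case True
      then have "?Z = {}" using loopless_ends(1)[OF H] by force
      then show ?thesis using m by (simp only: card.empty)
    next
      case False
      have "finite Z" using H Z(1) by (meson finite_Diff finite_loopless_multigraph_def finite_subset)
      then have "card Z \<noteq> 0" using False by simp
      moreover have "card ?Z \<le> card Z - 1"
        by (rule card_inner_edges_conn[OF H Z(1) _ Z(2) U0]) (use deg Z(1) in blast)
      ultimately show ?thesis using Z(3) by linarith
    qed
    ultimately show "\<exists>Z\<subseteq>verts (line_graph H) - touching H U.
        conn (touching H U \<union> Z) (adjacent (line_graph H)) \<and> card Z + 2 \<le> m"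
      by blast
  qed
  then show ?thesis by blast
qed

section \<open>Euler trails of components, and the last two line graph steps\<close>

lemma trail_sub:
  "trail (G\<lparr>verts := X, edges := F\<rparr>) x es y \<Longrightarrow> F \<subseteq> edges G \<Longrightarrow> trail G x es y"
  by (induction es arbitrary: x) auto

lemma trail_reach:
  assumes "trail G x es y" "set es \<subseteq> F" "v \<in> on_trail G x es"
  shows "reach G F x v"
  using assms
proof (induction es arbitrary: x)
  case Nil
  then show ?case by (simp add: on_trail_def)
next
  case (Cons e es)
  then obtain z where z: "ends G e = {x, z}" "trail G z es y" by auto
  have xz: "reach G F x z" using reach_edge[OF _ z(1)] Cons.prems(2) by simp
  show ?case
  proof (cases "v = x")
    case False
    then have "v \<in> on_trail G z es" using Cons.prems(3) z(1) unfolding on_trail_def by auto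
    then have "reach G F z v" using Cons z(2) by simp
    then show ?thesis using xz by (rule rtranclp_trans[rotated])
  qed simp
qed

text \<open>Apply \<open>euler_trail\<close> to the component \<open>M\<close> of \<open>h\<close>
  in the graph with edge set \<open>F\<close>; it inherits the bound on the number of odd
  vertices.\<close>

lemma euler_trail_component:
  assumes G: "finite_loopless_multigraph G" and F: "F \<subseteq> edges G" and h: "h \<in> verts G"
    and odd: "card {v \<in> verts G. odd (degree (G\<lparr>edges := F\<rparr>) v)} \<le> 2"
  obtains x es y where "trail G x es y" "distinct es" "on_trail G x es = {v. reach G F h v}"
proof -
  define X where "X = {v. reach G F h v}"
  define E where "E = {e \<in> F. ends G e \<subseteq> X}"
  define M where "M = G\<lparr>verts := X, edges := E\<rparr>"
  have fin: "finite (verts G)" "finite (edges G)" using G by (auto simp: finite_loopless_multigraph_def)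
  have XV: "X \<subseteq> verts G"
  proof
    fix v assume "v \<in> X"
    then have "reach G F h v" by (simp add: X_def)
    then show "v \<in> verts G"
    proof induction
      case (step v w)
      then obtain e where e: "e \<in> F" "ends G e = {v, w}" unfolding adjacent_sub by blast
      then have "e \<in> edges G" using F by blast
      then show ?case using loopless_ends(2)[OF G, of e] e(2) by simp
    qed (rule h)
  qed
  have adjM: "adjacent M v w" if v: "v \<in> X" and vw: "adjacent (G\<lparr>edges := F\<rparr>) v w" for v w
  proof -
    obtain e where e: "e \<in> F" "ends G e = {v, w}" using vw unfolding adjacent_sub by blast
    have "w \<in> X" using v vw unfolding X_def by (simp add: rtranclp.rtrancl_into_rtrancl)
    then have "e \<in> E" using e v by (simp add: E_def)
    then show ?thesis using e(2) unfolding adjacent_def M_def by auto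
  qed
  have M: "finite_loopless_multigraph M"
    using G F fin XV unfolding finite_loopless_multigraph_def M_def E_def
    by (auto intro: finite_subset)
  have "conn (verts M) (adjacent M)"
  proof (rule connI)
    fix Y assume Y: "Y \<subseteq> verts M" "Y \<noteq> {}"
      and cl: "\<And>x y. x \<in> Y \<Longrightarrow> y \<in> verts M \<Longrightarrow> adjacent M x y \<Longrightarrow> y \<in> Y"
    have VM: "verts M = X" by (simp add: M_def)
    obtain y where y: "y \<in> Y" using Y by blast
    have "x \<in> Y" if x: "x \<in> X" for x
    proof -
      have "reach G F h y" "reach G F h x" using x y Y(1) VM by (auto simp: X_def)
      then have "reach G F y x" by (rule rtranclp_trans[OF reach_sym])
      then show "x \<in> Y"
      proof induction
        case (step v w)
        have vX: "v \<in> X" using step.IH Y(1) VM by blast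
        then have "w \<in> X" using step.hyps(2) unfolding X_def by (simp add: rtranclp.rtrancl_into_rtrancl)
        then show ?case using cl[OF step.IH _ adjM[OF vX step.hyps(2)]] VM by simp
      qed (rule y)
    qed
    then show "verts M \<subseteq> Y" using VM by blast
  qed
  moreover have "verts M \<noteq> {}" by (auto simp: M_def X_def)
  moreover have "card {v \<in> verts M. odd (degree M v)} \<le> 2"
  proof -
    \<comment> \<open>No edge of \<open>F\<close> leaves its component, so restricting to
      \<open>X\<close> changes no degree there.\<close>
    have "degree M v = degree (G\<lparr>edges := F\<rparr>) v" if v: "v \<in> X" for v
    proof -
      have "ends G e \<subseteq> X" if e: "e \<in> F" "v \<in> ends G e" for e
      proof -
        have "e \<in> edges G" using e F by blast
        then obtain w where w: "ends G e = {v, w}" using ends_obtain[OF G _ e(2)] by blast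
        then have "reach G F v w" by (rule reach_edge[OF e(1)])
        then have "w \<in> X" using v unfolding X_def mem_Collect_eq by (rule rtranclp_trans[rotated])
        then show ?thesis using w v by simp
      qed
      then have "{e \<in> E. v \<in> ends G e} = {e \<in> F. v \<in> ends G e}" unfolding E_def by blast
      then show ?thesis unfolding degree_def M_def by simp
    qed
    then have "{v \<in> verts M. odd (degree M v)} \<subseteq> {v \<in> verts G. odd (degree (G\<lparr>edges := F\<rparr>) v)}"
      using XV by (auto simp: M_def)
    then have "card {v \<in> verts M. odd (degree M v)} \<le> card {v \<in> verts G. odd (degree (G\<lparr>edges := F\<rparr>) v)}"
      using fin by (intro card_mono) simp_all
    then show ?thesis using odd by (rule order_trans)
  qed
  ultimately obtain x es y where t: "trail M x es y" "distinct es" "on_trail M x es = verts M"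
    using euler_trail[OF M] by metis
  have "trail G x es y" using t(1) unfolding M_def by (rule trail_sub) (use F in \<open>auto simp: E_def\<close>)
  moreover have "on_trail G x es = X" using t(3) by (simp add: on_trail_def M_def)
  ultimately show thesis using that t(2) unfolding X_def by blast
qed

lemma traceable_line_line_graph:
  assumes sk: "skeleton H p U 2" and ne: "edges H \<noteq> {}" "edges (line_graph H) \<noteq> {}"
  shows "traceable (line_graph (line_graph H))"
proof -
  have H: "finite_loopless_multigraph H" and c: "conn (verts H) (adjacent H)"
    and p: "walk H p" "distinct p" "set p \<subseteq> U" and U: "U \<subseteq> verts H"
    and deg: "\<forall>v\<in>verts H - U. degree H v \<le> 2" and W: "card (verts H - U) \<le> 2"
    and tri: "\<forall>u\<in>U - set p. triangular H u"
    using sk unfolding skeleton_def by blast+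
  obtain Z where Z: "Z \<subseteq> verts H - U" "conn (U \<union> Z) (adjacent H)" "card Z = 0"
    using sk unfolding skeleton_def by auto
  have fin: "finite (verts H)" "finite (edges H)" using H by (auto simp: finite_loopless_multigraph_def)
  have "Z = {}" using Z(1,3) fin(1) by (metis card_0_eq finite_Diff finite_subset)
  then have cU: "conn (U \<union> {}) (adjacent H)" using Z(2) by simp
  have U0: "U \<noteq> {}" using p unfolding walk_def by auto
  let ?L = "line_graph H"
  have L: "finite_loopless_multigraph ?L" by (rule finite_loopless_line_graph[OF H])
  obtain l where l: "walk ?L l" "distinct l" "set l = touching H (set p)"
    using path_line_graph[OF H c ne(1) p(1,2)] .
  have l': "successively (adjacent ?L) l" "l \<noteq> []" "set l \<subseteq> verts ?L" using l(1) by (auto simp: walk_def)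
  obtain es where es: "trail ?L (hd l) es (last l)" "distinct es" "on_trail ?L (hd l) es = set l"
    using trail_of_path[OF l'(1) l(2) l'(2)] .
  \<comment> \<open>The switching starts from the edges of the path \<open>l\<close>: they connect
    all of \<open>set l\<close>, and only the two ends of the path can have odd degree.\<close>
  obtain F where F: "F \<subseteq> edges ?L"
    "\<And>v. odd (degree (?L\<lparr>edges := F\<rparr>) v) \<longleftrightarrow> odd (degree (?L\<lparr>edges := set es\<rparr>) v)"
    "\<And>x y. reach ?L (set es) x y \<Longrightarrow> reach ?L F x y"
    "\<And>a b c x y z. {a, b, c} \<subseteq> edges ?L \<Longrightarrow> ends ?L a = {x, y} \<Longrightarrow> ends ?L b = {y, z} \<Longrightarrow>
      ends ?L c = {z, x} \<Longrightarrow> reach ?L F x y"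
    using triangle_connected_subgraph[OF L trail_edges[OF es(1)]] by metis
  define h where "h = hd l"
  have h: "h \<in> set l" using l'(2) by (simp add: h_def)
  define X where "X = {v. reach ?L F h v}"
  have lX: "reach ?L F e f" if "e \<in> set l" "f \<in> set l" for e f
  proof -
    have "reach ?L F h e" "reach ?L F h f"
      using trail_reach[OF es(1) order_refl] es(3) that F(3) unfolding h_def by blast+
    then show ?thesis by (rule rtranclp_trans[OF reach_sym])
  qed
  \<comment> \<open>With \<open>{}\<close> as connecting set the second part of the union is empty,
    so this says that the edges meeting \<open>U\<close> lie in one component of
    \<open>F\<close>.\<close>
  have "conn (touching H U \<union> {e \<in> edges H. ends H e \<subseteq> {}}) (reach ?L F)"
  proof (rule conn_touching[OF H cU])
    fix u e f
    assume u: "u \<in> U \<union> {}" "u \<in> ends H e" "u \<in> ends H f" and ef: "e \<noteq> f"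
      and "e \<in> touching H U \<union> {e \<in> edges H. ends H e \<subseteq> {}}"
      and "f \<in> touching H U \<union> {e \<in> edges H. ends H e \<subseteq> {}}"
    then have e: "e \<in> edges H" and f: "f \<in> edges H" unfolding touching_def by blast+
    show "reach ?L F e f"
    proof (cases "u \<in> set p")
      case True
      then have "e \<in> set l" "f \<in> set l" using u e f unfolding l(3) touching_def by blast+
      then show ?thesis by (rule lX)
    next
      case False
      then have "triangular H u" using tri u(1) by blast
      then obtain g where g: "g \<in> edges H" "g \<noteq> e" "g \<noteq> f" "ends H e \<inter> ends H g \<noteq> {}" "ends H f \<inter> ends H g \<noteq> {}"
        using e f ef u unfolding triangular_def by blast
      have "ends H e \<inter> ends H f \<noteq> {}" using u by blast
      then have "{Join {|e, f|}, Join {|f, g|}, Join {|g, e|}} \<subseteq> edges ?L"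
        using e f g ef by (simp add: Join_in_edges_line_graph Int_commute)
      then show ?thesis by (rule F(4)) simp_all
    qed
  qed
  moreover have none: "{e \<in> edges H. ends H e \<subseteq> {}} = {}"
  proof -
    have "ends H e \<noteq> {}" if "e \<in> edges H" for e using loopless_ends(1)[OF H that] by auto
    then show ?thesis by blast
  qed
  ultimately have cT: "conn (touching H U) (reach ?L F)" unfolding none by simp
  have "touching H U \<inter> X = touching H U"
  proof (rule connD[OF cT])
    have "h \<in> touching H U" using h l(3) p(3) unfolding touching_def by blast
    then show "touching H U \<inter> X \<noteq> {}" unfolding X_def by blast
    show "f \<in> touching H U \<inter> X" if "e \<in> touching H U \<inter> X" "f \<in> touching H U" "reach ?L F e f" for e f
      using that rtranclp_trans[of _ h e f] unfolding X_def by blast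
  qed blast
  then have TX: "touching H U \<subseteq> X" by blast
  \<comment> \<open>Two outside vertices of degree at most 2 span at most one edge, parallel ones
    included, since one of them is also joined to \<open>U\<close>.\<close>
  have "card {e \<in> edges H. ends H e \<subseteq> verts H - U} \<le> card (verts H - U) - 1"
  proof (rule card_inner_edges_conn[OF H order_refl deg _ U0])
    show "conn (U \<union> (verts H - U)) (adjacent H)" using c U by (simp add: Un_absorb1)
  qed
  then have W1: "card (edges H - touching H U) \<le> 1" using W unfolding untouched_edges[OF H] by simp
  have touch: "touching ?L X = edges ?L"
  proof -
    have "joined a \<inter> X \<noteq> {}" if a: "a \<in> edges ?L" for a
    proof
      assume "joined a \<inter> X = {}"
      moreover have "joined a \<subseteq> edges H" "card (joined a) = 2" using loopless_ends[OF L a] by simp_all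
      ultimately have "joined a \<subseteq> edges H - touching H U" using TX by blast
      then have "card (joined a) \<le> card (edges H - touching H U)"
        using fin by (intro card_mono) simp_all
      then show False using W1 \<open>card (joined a) = 2\<close> by simp
    qed
    then show ?thesis unfolding touching_def by auto
  qed
  have "{v \<in> verts ?L. odd (degree (?L\<lparr>edges := F\<rparr>) v)} \<subseteq> {hd l, last l}"
  proof
    fix v assume "v \<in> {v \<in> verts ?L. odd (degree (?L\<lparr>edges := F\<rparr>) v)}"
    then have "odd (card {e \<in> set es. v \<in> ends ?L e})" using F(2)[of v] unfolding degree_sub by simp
    then show "v \<in> {hd l, last l}" unfolding trail_parity[OF L es(1,2)] by blast
  qed
  then have "card {v \<in> verts ?L. odd (degree (?L\<lparr>edges := F\<rparr>) v)} \<le> card {hd l, last l}"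
    by (intro card_mono) auto
  also have "\<dots> \<le> 2" by (simp add: card_insert_if)
  finally have odd: "card {v \<in> verts ?L. odd (degree (?L\<lparr>edges := F\<rparr>) v)} \<le> 2" .
  have "h \<in> verts ?L" using h l'(3) by blast
  then obtain x fs y where t: "trail ?L x fs y" "distinct fs" "on_trail ?L x fs = X"
    using euler_trail_component[OF L F(1) _ odd] unfolding X_def by metis
  show ?thesis by (rule traceable_line_graph[OF L t(1,2)]) (use t(3) touch ne(2) in simp_all)
qed

text \<open>Rounds are repeated until \<open>m = 2\<close>. The edges may run out earlier, when a
  single vertex is left; hence the claim for some \<open>j \<le> m\<close>.\<close>

lemma skeleton_traceable:
  assumes "skeleton H p U m" "2 \<le> m"
  shows "\<exists>j\<le>m. traceable ((line_graph ^^ j) H)"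
  using assms(2,1)
proof (induction m arbitrary: H p U rule: dec_induct)
  case base
  have H: "finite_loopless_multigraph H" "conn (verts H) (adjacent H)" "verts H \<noteq> {}"
    using base unfolding skeleton_def walk_def by auto
  show ?case
  proof (cases "edges H = {} \<or> edges (line_graph H) = {}")
    case True
    show ?thesis
    proof (cases "edges H = {}")
      case True
      then have "traceable ((line_graph ^^ 0) H)" using traceable_edgeless[OF H(2,3)] by simp
      then show ?thesis by blast
    next
      case False
      then have "traceable (line_graph H)"
        using True conn_line_graph[OF H(1,2)] by (intro traceable_edgeless) auto
      then have "traceable ((line_graph ^^ 1) H)" by simp
      then show ?thesis by (metis one_le_numeral)
    qed
  next
    case False
    then have "traceable (line_graph (line_graph H))"
      using traceable_line_line_graph[OF base] by blast
    then have "traceable ((line_graph ^^ 2) H)" by (simp add: numeral_2_eq_2)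
    then show ?thesis by blast
  qed
next
  case (step m)
  have H: "conn (verts H) (adjacent H)" "verts H \<noteq> {}"
    using step.prems unfolding skeleton_def walk_def by auto
  show ?case
  proof (cases "edges H = {}")
    case True
    then have "traceable ((line_graph ^^ 0) H)" using traceable_edgeless[OF H] by simp
    then show ?thesis by blast
  next
    case False
    then obtain p' where "skeleton (line_graph H) p' (touching H U) m"
      using skeleton_line_graph[OF step.prems step.hyps(1)] by blast
    then obtain j where j: "j \<le> m" "traceable ((line_graph ^^ j) (line_graph H))"
      using step.IH by blast
    then have "traceable ((line_graph ^^ Suc j) H)" by (simp add: funpow_swap1)
    then show ?thesis using j(1) by (meson Suc_le_mono)
  qed
qed

section \<open>The initial skeleton\<close>

text \<open>The critical case is a single vertex \<open>y\<close> of degree at least 3 outside the path. If a shortest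
  walk from \<open>y\<close> to the path used all other outside vertices, then all edges at \<open>y\<close> would end in
  the second vertex of the walk, whose degree is at most 2.\<close>

lemma initial_connector:
  assumes H: "finite_loopless_multigraph H" "connected_graph H" and p: "walk H p"
    and k: "2 \<le> card (verts H - set p)"
    and U: "U = set p \<union> {v \<in> verts H. 3 \<le> degree H v}"
  shows "\<exists>Z\<subseteq>verts H - U. conn (U \<union> Z) (adjacent H) \<and> card Z + 2 \<le> card (verts H - set p)"
proof -
  define W where "W = verts H - U"
  define B where "B = {v \<in> verts H - set p. 3 \<le> degree H v}"
  have fin: "finite (verts H)" using H by (simp add: finite_loopless_multigraph_def)
  have p': "p \<noteq> []" "set p \<subseteq> verts H" "successively (adjacent H) p" using p by (auto simp: walk_def)
  have UB: "U = set p \<union> B" using U p'(2) unfolding B_def by blast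
  have sym: "symp (adjacent H)" by (rule sympI[OF adjacent_sym])
  have cp: "conn (set p) (adjacent H)" by (rule conn_successively[OF sym p'(3)])
  have "verts H - set p = B \<union> W" "B \<inter> W = {}" unfolding W_def UB unfolding B_def by blast+
  moreover have finB: "finite B" and "finite W" using fin by (simp_all add: B_def W_def)
  ultimately have BW: "card (verts H - set p) = card B + card W"
    by (simp only: card_Un_disjoint)
  show ?thesis
  \<comment> \<open>By \<open>BW\<close> this asks whether \<open>B\<close> has at least two
    elements; if so, all of \<open>W\<close> may serve as connecting set.\<close>
  proof (cases "card W + 2 \<le> card (verts H - set p)")
    case True
    have "U \<union> W = verts H" unfolding W_def U using p'(2) by blast
    then have "conn (U \<union> W) (adjacent H)" using connected_graph_conn[OF H(2)] by simp
    then show ?thesis using True unfolding W_def by blast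
  next
    case False
    have "card B \<le> 1" using False BW by linarith
    show ?thesis
    proof (cases "B = {}")
      case True
      then have "conn (U \<union> {}) (adjacent H)" using cp UB by simp
      moreover have "card {} + 2 \<le> card (verts H - set p)" using k by simp
      ultimately show ?thesis by blast
    next
      case False
      then obtain y where B: "B = {y}"
        using \<open>card B \<le> 1\<close> finB by (metis One_nat_def card_1_singletonE card_0_eq le_SucE le_zero_eq)
      then have y: "y \<in> verts H" "y \<notin> set p" "3 \<le> degree H y" unfolding B_def by blast+
      define P where "P xs \<longleftrightarrow> walk H xs \<and> hd xs = y \<and> last xs \<in> set p" for xs
      have "hd p \<in> set p" using p'(1) by simp
      moreover from this obtain xs where "walk H xs" "hd xs = y" "last xs = hd p"
        using H(2) y(1) p'(2) unfolding connected_graph_def by blast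
      ultimately have "\<exists>xs. P xs" unfolding P_def by metis
      \<comment> \<open>The inner vertices \<open>zs\<close> of a shortest walk from
        \<open>y\<close> to the path will be the connecting set; minimality keeps them off the path
        and away from \<open>y\<close>.\<close>
      then obtain xs where xs: "P xs" and least: "\<And>ys. P ys \<Longrightarrow> length xs \<le> length ys"
        using ex_has_least_nat[of P _ length] by blast
      have xs': "xs \<noteq> []" "set xs \<subseteq> verts H" "successively (adjacent H) xs" "hd xs = y" "last xs \<in> set p"
        using xs by (auto simp: P_def walk_def)
      obtain ys where ys: "xs = y # ys" using xs'(1,4) by (cases xs) auto
      have "ys \<noteq> []" using ys xs'(5) y(2) by auto
      then obtain zs q where zs: "xs = y # zs @ [q]" using ys by (metis append_butlast_last_id)
      have q: "q \<in> set p" using xs'(5) zs by simp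
      have disj: "z \<notin> set p" if z: "z \<in> set zs" for z
      proof
        assume "z \<in> set p"
        obtain as bs where zs': "zs = as @ z # bs" using split_list[OF z] by blast
        then have xs_eq: "xs = (y # as @ [z]) @ bs @ [q]" using zs by simp
        have "successively (adjacent H) (y # as @ [z])"
          using xs'(3) unfolding xs_eq successively_append_iff by blast
        then have "P (y # as @ [z])"
          using xs'(2) \<open>z \<in> set p\<close> unfolding xs_eq P_def walk_def by simp
        then show False using least[of "y # as @ [z]"] xs_eq by simp
      qed
      have "y \<notin> set zs"
      proof
        assume z: "y \<in> set zs"
        obtain as bs where zs': "zs = as @ y # bs" using split_list[OF z] by blast
        then have xs_eq: "xs = (y # as) @ (y # bs @ [q])" using zs by simp
        have "successively (adjacent H) (y # bs @ [q])"
          using xs'(3) unfolding xs_eq successively_append_iff by blast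
        then have "P (y # bs @ [q])"
          using xs'(2) q unfolding xs_eq P_def walk_def by simp
        then show False using least[of "y # bs @ [q]"] xs_eq by simp
      qed
      then have zW: "set zs \<subseteq> W"
        using disj xs'(2) zs unfolding W_def UB B by auto
      have "conn (set p \<union> set xs) (adjacent H)"
        using conn_Un[OF cp conn_successively[OF sym xs'(3)]] q zs by auto
      moreover have "set p \<union> set xs = U \<union> set zs" using q unfolding UB B zs by auto
      ultimately have c: "conn (U \<union> set zs) (adjacent H)" by simp
      have "card (set zs) + 2 \<le> card (verts H - set p)"
      \<comment> \<open>Since \<open>B\<close> is a single vertex, failure of the bound forces
        \<open>zs\<close> to use up all of \<open>W\<close>.\<close>
      proof (rule ccontr)
        assume small: "\<not> ?thesis"
        have "card W + 1 = card (verts H - set p)" using BW B by simp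
        then have "card W \<le> card (set zs)" using small by linarith
        moreover have "finite W" using fin by (simp add: W_def)
        ultimately have W: "set zs = W" using zW by (intro card_seteq)
        have "zs \<noteq> []" using small k by auto
        then obtain z ws where zw: "zs = z # ws" by (cases zs) auto
        have "{e \<in> edges H. y \<in> ends H e} \<subseteq> {e \<in> edges H. z \<in> ends H e}"
        proof
          fix e assume "e \<in> {e \<in> edges H. y \<in> ends H e}"
          then have e: "e \<in> edges H" "y \<in> ends H e" by blast+
          obtain w where w: "ends H e = {y, w}" "y \<noteq> w" using ends_obtain[OF H(1) e] .
          have yw: "adjacent H y w" using e w unfolding adjacent_def by blast
          have wV: "w \<in> verts H" using loopless_ends(2)[OF H(1) e(1)] w by simp
          have "w \<notin> set p"
          proof
            assume "w \<in> set p"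
            then have "P [y, w]" using y(1) wV yw by (simp add: P_def walk_def)
            then show False using least[of "[y, w]"] zs zw by simp
          qed
          then have ww: "w \<in> set (z # ws)" using w(2) wV W unfolding W_def UB B zw by blast
          \<comment> \<open>A neighbour of \<open>y\<close> further along the walk would give a
            shortcut, so every edge at \<open>y\<close> is parallel to the first step of the
            walk.\<close>
          have "w = z"
          proof (rule ccontr)
            assume "w \<noteq> z"
            then have "w \<in> set ws" using ww by simp
            then obtain as bs where ws: "ws = as @ w # bs" by (meson split_list)
            then have xs_eq: "xs = (y # z # as) @ (w # bs @ [q])" using zs zw by simp
            have "successively (adjacent H) (w # bs @ [q])"
              using xs'(3) unfolding xs_eq successively_append_iff by blast
            then have "P (y # w # bs @ [q])"
              using xs'(2) q yw unfolding xs_eq P_def walk_def by simp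
            then show False using least[of "y # w # bs @ [q]"] xs_eq by simp
          qed
          then show "e \<in> {e \<in> edges H. z \<in> ends H e}" using e(1) w(1) by simp
        qed
        then have "degree H y \<le> degree H z"
          unfolding degree_def using H(1) by (intro card_mono) (auto simp: finite_loopless_multigraph_def)
        moreover have "z \<in> W" using W zw by auto
        then have "degree H z \<le> 2" unfolding W_def U by auto
        ultimately show False using y(3) by simp
      qed
      then show ?thesis using c zW unfolding W_def by blast
    qed
  qed
qed

text \<open>This holds for an arbitrary path \<open>p\<close>; the diameter enters only later,
  through the length of the chosen path.\<close>

lemma traceable_of_path:
  assumes H: "finite_loopless_multigraph H" "connected_graph H" and p: "walk H p" "distinct p"
  shows "\<exists>j\<le>max 1 (card (verts H) - length p). traceable ((line_graph ^^ j) H)"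
proof -
  have c: "conn (verts H) (adjacent H)" by (rule connected_graph_conn[OF H(2)])
  have fin: "finite (verts H)" using H by (simp add: finite_loopless_multigraph_def)
  have p': "p \<noteq> []" "set p \<subseteq> verts H" "successively (adjacent H) p" using p by (auto simp: walk_def)
  have ne: "verts H \<noteq> {}" using p'(1,2) by auto
  let ?k = "card (verts H - set p)"
  have k: "card (verts H) - length p = ?k"
    using p'(2) p(2) by (simp add: card_Diff_subset distinct_card)
  consider "?k = 0" | "?k = 1" | "2 \<le> ?k" by linarith
  then show ?thesis
  proof cases
    case 1
    then have "set p = verts H" using fin p'(2) by auto
    then have "traceable ((line_graph ^^ 0) H)"
      using p by (auto simp: traceable_def hamiltonian_path_def)
    then show ?thesis by blast
  next
    case 2
    show ?thesis
    proof (cases "edges H = {}")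
      case True
      then have "traceable ((line_graph ^^ 0) H)" using traceable_edgeless[OF c ne] by simp
      then show ?thesis by blast
    next
      case False
      obtain es where es: "trail H (hd p) es (last p)" "distinct es" "on_trail H (hd p) es = set p"
        using trail_of_path[OF p'(3) p(2) p'(1)] .
      have "ends H e \<inter> set p \<noteq> {}" if e: "e \<in> edges H" for e
      proof
        assume "ends H e \<inter> set p = {}"
        then have "ends H e \<subseteq> verts H - set p" using loopless_ends(2)[OF H(1) e] by blast
        then have "card (ends H e) \<le> ?k" using fin by (intro card_mono) simp_all
        then show False using 2 loopless_ends(1)[OF H(1) e] by simp
      qed
      then have "touching H (on_trail H (hd p) es) = edges H"
        unfolding es(3) touching_def by blast
      then have "traceable ((line_graph ^^ 1) H)"
        using traceable_line_graph[OF H(1) es(1,2) _ False] by simp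
      then show ?thesis by (meson max.cobounded1)
    qed
  next
    case 3
    define U where "U = set p \<union> {v \<in> verts H. 3 \<le> degree H v}"
    have "skeleton H p U ?k"
      unfolding skeleton_def
    proof (intro conjI)
      show "set p \<subseteq> U" "U \<subseteq> verts H" using p'(2) unfolding U_def by blast+
      show "\<forall>v\<in>verts H - U. degree H v \<le> 2" unfolding U_def by auto
      show "card (verts H - U) \<le> ?k" using fin unfolding U_def by (intro card_mono) auto
      show "\<forall>u\<in>U - set p. triangular H u"
        using triangularI_degree[OF H(1)] unfolding U_def by blast
      show "\<exists>Z\<subseteq>verts H - U. conn (U \<union> Z) (adjacent H) \<and> card Z + 2 \<le> ?k"
        by (rule initial_connector[OF H p(1) 3 U_def])
    qed (fact H(1) c p)+
    then have "\<exists>j\<le>?k. traceable ((line_graph ^^ j) H)" using 3 by (rule skeleton_traceable)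
    then show ?thesis unfolding k by (meson max.coboundedI2)
  qed
qed

text \<open>A shortest walk between two vertices at maximal distance repeats no vertex, since the
  stretch between two occurrences could be cut out.\<close>

lemma diametral_path:
  assumes "finite_loopless_multigraph G" "connected_graph G"
  obtains p where "walk G p" "distinct p" "length p = Suc (graph_diam G)"
proof -
  let ?D = "{graph_dist G u v | u v. u \<in> verts G \<and> v \<in> verts G}"
  have "?D = (\<lambda>(u, v). graph_dist G u v) ` (verts G \<times> verts G)" by auto
  then have "finite ?D" using assms(1) by (simp add: finite_loopless_multigraph_def)
  moreover have "?D \<noteq> {}" using assms(2) unfolding connected_graph_def by blast
  ultimately have "graph_diam G \<in> ?D" unfolding graph_diam_def by (rule Max_in)
  then obtain u v where uv: "u \<in> verts G" "v \<in> verts G" "graph_diam G = graph_dist G u v" by blast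
  define Q where "Q k \<longleftrightarrow> (\<exists>xs. walk G xs \<and> hd xs = u \<and> last xs = v \<and> length xs = Suc k)" for k
  have d: "graph_diam G = (LEAST k. Q k)" unfolding uv(3) graph_dist_def Q_def ..
  obtain xs where xs: "walk G xs" "hd xs = u" "last xs = v"
    using assms(2) uv(1,2) unfolding connected_graph_def by blast
  then have "length xs = Suc (length xs - 1)" by (cases xs) (auto simp: walk_def)
  then have "Q (length xs - 1)" using xs unfolding Q_def by blast
  then have "Q (graph_diam G)" unfolding d by (rule LeastI)
  then obtain p where p: "walk G p" "hd p = u" "last p = v" "length p = Suc (graph_diam G)"
    unfolding Q_def by blast
  have "distinct p"
  proof (rule ccontr)
    assume "\<not> distinct p"
    then obtain as bs cs y where dec: "p = as @ [y] @ bs @ [y] @ cs" using not_distinct_decomp by blast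
    let ?p = "as @ [y] @ cs"
    have "successively (adjacent G) p" "set p \<subseteq> verts G" using p(1) unfolding walk_def by blast+
    then have "walk G ?p" unfolding dec walk_def by (auto simp: successively_append_iff successively_Cons)
    moreover have "hd ?p = u" using p(2) unfolding dec by (cases as) auto
    moreover have "last ?p = v" using p(3) unfolding dec by (cases cs) auto
    moreover have "length ?p = Suc (length as + length cs)" by simp
    ultimately have "Q (length as + length cs)" unfolding Q_def by blast
    then have "graph_diam G \<le> length as + length cs" unfolding d by (rule Least_le)
    then show False using p(4) unfolding dec by simp
  qed
  then show thesis using that p by blast
qed

section \<open>Transfer to the embedded graph, and the index\<close>

lemma finite_loopless_embed:
  assumes "finite_loopless_multigraph G"
  shows "finite_loopless_multigraph (embed G)"
  using assms unfolding finite_loopless_multigraph_def embed_def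
  by (auto simp: card_image inj_on_def)

lemma walk_embed:
  assumes "walk G xs"
  shows "walk (embed G) (map Vertex xs)"
proof -
  have "verts (embed G) = Vertex ` verts G" by (simp add: embed_def)
  then show ?thesis using assms by (auto simp: walk_def successively_map)
qed

lemma connected_graph_embed:
  assumes "connected_graph G"
  shows "connected_graph (embed G)"
proof -
  have V: "verts (embed G) = Vertex ` verts G" by (simp add: embed_def)
  have "\<exists>xs. walk (embed G) xs \<and> hd xs = Vertex u \<and> last xs = Vertex v"
    if uv: "u \<in> verts G" "v \<in> verts G" for u v
  proof -
    obtain xs where xs: "walk G xs" "hd xs = u" "last xs = v"
      using assms uv unfolding connected_graph_def by blast
    then have "xs \<noteq> []" by (simp add: walk_def)
    then show ?thesis using walk_embed[OF xs(1)] xs(2,3)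
      by (intro exI[of _ "map Vertex xs"]) (simp add: hd_map last_map)
  qed
  then show ?thesis using assms unfolding connected_graph_def V by blast
qed

lemma edges_line_graph_empty: "edges H = {} \<Longrightarrow> edges (line_graph H) = {}"
  by (simp add: line_graph_def)

text \<open>If level \<open>k\<close> has no edges, every later level is empty, whereas a
  hamiltonian path is a nonempty list. This supplies the condition on earlier line graphs in
  \<open>hamiltonian_path_index\<close>.\<close>

lemma traceable_imp_edges:
  assumes "traceable ((line_graph ^^ j) H)" "k < j"
  shows "edges ((line_graph ^^ k) H) \<noteq> {}"
proof
  assume E: "edges ((line_graph ^^ k) H) = {}"
  have "verts ((line_graph ^^ (Suc k + t)) H) = {} \<and> edges ((line_graph ^^ (Suc k + t)) H) = {}" for t
  proof (induction t)
    case 0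
    show ?case using E by (simp add: edges_line_graph_empty)
  next
    case (Suc t)
    then show ?case by (simp add: edges_line_graph_empty)
  qed
  from this[of "j - Suc k"] have "verts ((line_graph ^^ j) H) = {}" using assms(2) by simp
  then show False using assms(1) by (auto simp: traceable_def hamiltonian_path_def walk_def)
qed

theorem corollary17:
  fixes G :: "('v, 'e) multigraph" and n :: nat
  assumes "finite_loopless_multigraph G"
    and "connected_graph G"
    and "card (verts G) = n"
  shows "hamiltonian_path_index G \<le> enat (max 1 (n - graph_diam G - 1))"
proof -
  obtain p where p: "walk G p" "distinct p" "length p = Suc (graph_diam G)"
    using diametral_path[OF assms(1,2)] .
  have "distinct (map Vertex p :: ('v, 'e) element list)"
    using p(2) by (simp add: distinct_map inj_on_def)
  then have "\<exists>j\<le>max 1 (card (verts (embed G)) - length p). traceable ((line_graph ^^ j) (embed G))"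
    using traceable_of_path[OF finite_loopless_embed[OF assms(1)]
        connected_graph_embed[OF assms(2)] walk_embed[OF p(1)]] by simp
  moreover have "card (verts (embed G)) = n" using assms(3) by (simp add: embed_def card_image inj_on_def)
  \<comment> \<open>\<open>length p\<close> counts vertices, one more than the diameter; hence the
    final \<open>- 1\<close> in the bound.\<close>
  ultimately obtain j where j: "j \<le> max 1 (n - graph_diam G - 1)" "traceable (iterated_line_graph j G)"
    using p(3) by (auto simp: iterated_line_graph_def)
  have "\<forall>k<j. edges (iterated_line_graph k G) \<noteq> {}"
    using traceable_imp_edges j(2) unfolding iterated_line_graph_def by blast
  then have "hamiltonian_path_index G \<le> enat j"
    unfolding hamiltonian_path_index_def using j(2) by (intro Inf_lower) blast
  also have "\<dots> \<le> enat (max 1 (n - graph_diam G - 1))" using j(1) by simp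
  finally show ?thesis .
qed

end
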